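(* Let the project (as defined in the context) be threshold-indexable (i.e., both thresholdable and indexable) with Whittle index $\lambda^*(\cdot)$. Then: (a) $f(x,x)-\lambda^*(x)g(x,x)=0=f(x,x^-)-\lambda^*(x)g(x,x^-)$ for every state $x\in\mathsf X$; (b) $\lambda^*(x)=m(x)$, where $m(x)=f(x,x)/g(x,x)$, for any state $x$ with $g(x,x)\ne0$; (c) if $g(x,z)>0$ for every $x\in\mathsf X$ and $z\in\overline{\mathbb R}$, then $\lambda^*(\cdot)=m(\cdot)$ on $\mathsf X$.
   Context: Project model. $\mathsf X=\{x\in\mathbb R:\ell\le x\le u\}$ with $-\infty\le\ell<u\le\infty$; all sets and functions are Borel measurable. A project has state $X_t\in\mathsf X$ and action $A_t\in\{0,1\}$ ($1$ = active, $0$ = passive) at times $t=0,1,\dots$. When $(X_t,A_t)=(x,a)$ it yields reward $r(x,a)$, consumes $c(x,a)$ units of a resource, and $X_{t+1}\sim\kappa^a(x,\cdot)$, with $\kappa^0,\kappa^1$ Markov transition kernels on $\mathsf X$. The discount factor is $\beta\in[0,1)$. Standing assumption: for each $a\in\{0,1\}$, $r(\cdot,a)$ and $c(\cdot,a)$ are continuous on $\mathsf X$, $0\le c(x,0)<c(x,1)$ for all $x$, and there are a function $w:\mathsf X\to[1,\infty)$ and constants $M>0$, $\beta\le\gamma<1$ with $\max\{|r(x,a)|,c(x,a)\}\le M w(x)$ and $\beta\int w(y)\,\kappa^a(x,dy)\le\gamma w(x)$ for all $x,a$. Policies and metrics. $\Pi$ is the class of nonanticipative (history-dependent, possibly randomized)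 policies. $F(x,\pi)=\mathsf E_x^\pi[\sum_{t\ge0}\beta^t r(X_t,A_t)]$, $G(x,\pi)=\mathsf E_x^\pi[\sum_{t\ge0}\beta^t c(X_t,A_t)]$ with $X_0=x$. For $\lambda\in\mathbb R$, $V_\lambda(x,\pi)=F(x,\pi)-\lambda G(x,\pi)$ and $V^*_\lambda(x)=\sup_{\pi\in\Pi}V_\lambda(x,\pi)$. For $z\in\overline{\mathbb R}=\mathbb R\cup\{-\infty,\infty\}$ the $z$-policy takes $A_t=1$ iff $X_t>z$, and the $z^-$-policy takes $A_t=1$ iff $X_t\ge z$. For an action $a$ and a policy $\pi$, $\langle a,\pi\rangle$ takes action $a$ at time $0$ and follows $\pi$ afterwards. Marginal metrics: $f(x,\pi)=F(x,\langle1,\pi\rangle)-F(x,\langle0,\pi\rangle)$, $g(x,\pi)=G(x,\langle1,\pi\rangle)-G(x,\langle0,\pi\rangle)$; $f(x,z),g(x,z)$ (resp. $f(x,z^-),g(x,z^-)$) are these for the $z$-policy (resp. $z^-$-policy). Indexability and thresholdability. Let $V_\lambda^{\langle a,*\rangle}(x)=r(x,a)-\lambda c(x,a)+\beta\int V_\lambda^*(y)\,\kappa^a(x,dy)$ and $\Delta_\lambda(x)=V_\lambda^{\langle1,*\rangle}(x)-V_\lambda^{\langle0,*\rangle}(x)$. The project is indexable with Whittle index $\lambda^*:\mathsf X\to\mathbb R$ if $\operatorname{sgn}\Delta_\lambda(x)=\operatorname{sgn}(\lambda^*(x)-\lambda)$ for all $x\in\mathsf X$, $\lambda\in\mathbb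 R$, where $\operatorname{sgn}\in\{-1,0,1\}$. It is thresholdable if there is a map $z^*:\mathbb R\to\overline{\mathbb R}$ such that for all $x\in\mathsf X$, $\lambda\in\mathbb R$: $x\le z^*(\lambda)$ implies $\Delta_\lambda(x)\le0$, and $x\ge z^*(\lambda)$ implies $\Delta_\lambda(x)\ge0$. *)

theory Defs
  imports "HOL-Probability.Probability"
begin

text \<open>
  Actions are Booleans: \<^term>\<open>True\<close> is the active action 1 and \<^term>\<open>False\<close> the passive action 0.
\<close>

record project =
  state_lower :: ereal
  state_upper :: ereal
  reward :: "real \<Rightarrow> bool \<Rightarrow> real"
  resource :: "real \<Rightarrow> bool \<Rightarrow> real"
  transition :: "bool \<Rightarrow> real \<Rightarrow> real measure"
  discount :: real

definition states :: "project \<Rightarrow> real set" where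
  "states P = {x. state_lower P \<le> ereal x \<and> ereal x \<le> state_upper P}"

definition state_space :: "project \<Rightarrow> real measure" where
  "state_space P = restrict_space borel (states P)"

definition action_space :: "bool measure" where
  "action_space = count_space UNIV"

definition state_action_space :: "project \<Rightarrow> (real \<times> bool) measure" where
  "state_action_space P = state_space P \<Otimes>\<^sub>M action_space"

text \<open>
  The drift condition uses the nonnegative integral, so that it cannot hold vacuously
  through the convention that the Bochner integral of a non-integrable function is 0.
\<close>

definition weight_condition :: "project \<Rightarrow> (real \<Rightarrow> real) \<Rightarrow> real \<Rightarrow> real \<Rightarrow> bool" where
  "weight_condition P w M \<gamma> \<longleftrightarrow>
     w \<in> borel_measurable (state_space P) \<and> (\<forall>x\<in>states P. 1 \<le> w x) \<and>
     0 < M \<and> discount P \<le> \<gamma> \<and> \<gamma> < 1 \<and>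
     (\<forall>x\<in>states P. \<forall>a. max \<bar>reward P x a\<bar> (resource P x a) \<le> M * w x) \<and>
     (\<forall>x\<in>states P. \<forall>a.
        ennreal (discount P) * (\<integral>\<^sup>+ y. ennreal (w y) \<partial>transition P a x) \<le> ennreal (\<gamma> * w x))"

definition discounted_project :: "project \<Rightarrow> bool" where
  "discounted_project P \<longleftrightarrow>
     state_lower P < state_upper P \<and>
     0 \<le> discount P \<and> discount P < 1 \<and>
     (\<forall>a. transition P a \<in> state_space P \<rightarrow>\<^sub>M prob_algebra (state_space P)) \<and>
     (\<forall>a. continuous_on (states P) (\<lambda>x. reward P x a)) \<and>
     (\<forall>a. continuous_on (states P) (\<lambda>x. resource P x a)) \<and>
     (\<forall>x\<in>states P. 0 \<le> resource P x False \<and> resource P x False < resource P x True) \<and>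
     (\<exists>w M \<gamma>. weight_condition P w M \<gamma>)"

text \<open>
  At time \<open>t\<close> a policy sees the past state-action pairs, as an extensional function on
  \<open>{0..<t}\<close>, together with the current state, and returns a distribution on actions.
\<close>

type_synonym policy = "nat \<Rightarrow> (nat \<Rightarrow> real \<times> bool) \<times> real \<Rightarrow> bool measure"

definition policies :: "project \<Rightarrow> policy set" where
  "policies P = {\<pi>. \<forall>t. \<pi> t \<in>
     (PiM {0..<t} (\<lambda>_. state_action_space P) \<Otimes>\<^sub>M state_space P) \<rightarrow>\<^sub>M prob_algebra action_space}"

definition threshold_policy :: "ereal \<Rightarrow> policy" where
  "threshold_policy z = (\<lambda>t (h, x). return action_space (z < ereal x))"

definition threshold_policy_left :: "ereal \<Rightarrow> policy" where
  "threshold_policy_left z = (\<lambda>t (h, x). return action_space (z \<le> ereal x))"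

text \<open>
  \<open>action_then a \<pi>\<close> takes action \<open>a\<close> at time 0 and then starts \<open>\<pi>\<close> afresh at time 1: the
  history handed to \<open>\<pi>\<close> omits the pair of time 0, and time is shifted by one.
\<close>

definition action_then :: "bool \<Rightarrow> policy \<Rightarrow> policy" where
  "action_then a \<pi> = (\<lambda>t (h, x). case t of
     0 \<Rightarrow> return action_space a
   | Suc n \<Rightarrow> \<pi> n (\<lambda>i\<in>{0..<n}. h (Suc i), x))"

text \<open>
  \<open>step_law P \<pi> x t h\<close> is the conditional law of \<open>(X\<^sub>t, A\<^sub>t)\<close> given the pairs \<open>h\<close> of the times
  before \<open>t\<close>, when \<open>X\<^sub>0 = x\<close>. The law of the whole trajectory is the projective limit
  given by the Ionescu-Tulcea theorem; the lemma \<open>Ionescu_Tulcea_step_law\<close> below checks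
  its hypotheses.
\<close>

definition state_law :: "project \<Rightarrow> real \<Rightarrow> nat \<Rightarrow> (nat \<Rightarrow> real \<times> bool) \<Rightarrow> real measure" where
  "state_law P x t h = (case t of
     0 \<Rightarrow> return (state_space P) x
   | Suc n \<Rightarrow> transition P (snd (h n)) (fst (h n)))"

definition step_law ::
  "project \<Rightarrow> policy \<Rightarrow> real \<Rightarrow> nat \<Rightarrow> (nat \<Rightarrow> real \<times> bool) \<Rightarrow> (real \<times> bool) measure" where
  "step_law P \<pi> x t h =
     state_law P x t h \<bind> (\<lambda>y. \<pi> t (h, y) \<bind> (\<lambda>a. return (state_action_space P) (y, a)))"

definition trajectory_law :: "project \<Rightarrow> policy \<Rightarrow> real \<Rightarrow> (nat \<Rightarrow> real \<times> bool) measure" where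
  "trajectory_law P \<pi> x =
     projective_family.lim UNIV
       (Ionescu_Tulcea.CI (step_law P \<pi> x) (\<lambda>_. state_action_space P))
       (\<lambda>_. state_action_space P)"

definition reward_metric :: "project \<Rightarrow> real \<Rightarrow> policy \<Rightarrow> real" where
  "reward_metric P x \<pi> =
     (\<integral>\<omega>. (\<Sum>t. discount P ^ t * reward P (fst (\<omega> t)) (snd (\<omega> t))) \<partial>trajectory_law P \<pi> x)"

definition resource_metric :: "project \<Rightarrow> real \<Rightarrow> policy \<Rightarrow> real" where
  "resource_metric P x \<pi> =
     (\<integral>\<omega>. (\<Sum>t. discount P ^ t * resource P (fst (\<omega> t)) (snd (\<omega> t))) \<partial>trajectory_law P \<pi> x)"

definition marginal_reward :: "project \<Rightarrow> real \<Rightarrow> policy \<Rightarrow> real" where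
  "marginal_reward P x \<pi> =
     reward_metric P x (action_then True \<pi>) - reward_metric P x (action_then False \<pi>)"

definition marginal_resource :: "project \<Rightarrow> real \<Rightarrow> policy \<Rightarrow> real" where
  "marginal_resource P x \<pi> =
     resource_metric P x (action_then True \<pi>) - resource_metric P x (action_then False \<pi>)"

definition mp_index :: "project \<Rightarrow> real \<Rightarrow> real" where
  "mp_index P x =
     marginal_reward P x (threshold_policy (ereal x)) /
     marginal_resource P x (threshold_policy (ereal x))"

definition policy_value :: "project \<Rightarrow> real \<Rightarrow> real \<Rightarrow> policy \<Rightarrow> real" where
  "policy_value P lam x \<pi> = reward_metric P x \<pi> - lam * resource_metric P x \<pi>"

definition optimal_value :: "project \<Rightarrow> real \<Rightarrow> real \<Rightarrow> real" where
  "optimal_value P lam x = (SUP \<pi>\<in>policies P. policy_value P lam x \<pi>)"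

definition action_value :: "project \<Rightarrow> real \<Rightarrow> bool \<Rightarrow> real \<Rightarrow> real" where
  "action_value P lam a x =
     reward P x a - lam * resource P x a
     + discount P * (\<integral>y. optimal_value P lam y \<partial>transition P a x)"

definition action_gap :: "project \<Rightarrow> real \<Rightarrow> real \<Rightarrow> real" where
  "action_gap P lam x = action_value P lam True x - action_value P lam False x"

definition indexable_with :: "project \<Rightarrow> (real \<Rightarrow> real) \<Rightarrow> bool" where
  "indexable_with P whittle \<longleftrightarrow>
     (\<forall>x\<in>states P. \<forall>lam. sgn (action_gap P lam x) = sgn (whittle x - lam))"

definition thresholdable :: "project \<Rightarrow> bool" where
  "thresholdable P \<longleftrightarrow>
     (\<exists>z :: real \<Rightarrow> ereal. \<forall>x\<in>states P. \<forall>lam.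
        (ereal x \<le> z lam \<longrightarrow> action_gap P lam x \<le> 0) \<and>
        (z lam \<le> ereal x \<longrightarrow> 0 \<le> action_gap P lam x))"

definition threshold_indexable_with :: "project \<Rightarrow> (real \<Rightarrow> real) \<Rightarrow> bool" where
  "threshold_indexable_with P whittle \<longleftrightarrow> thresholdable P \<and> indexable_with P whittle"

lemma space_state_space [simp]: "space (state_space P) = states P"
  by (simp add: state_space_def space_restrict_space)

lemma space_action_space [simp]: "space action_space = UNIV"
  by (simp add: action_space_def)

lemma step_law_measurable:
  assumes P: "discounted_project P" and \<pi>: "\<pi> \<in> policies P" and x: "x \<in> states P"
  shows "step_law P \<pi> x t \<in>
    PiM {0..<t} (\<lambda>_. state_action_space P) \<rightarrow>\<^sub>M prob_algebra (state_action_space P)"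
proof -
  let ?H = "PiM {0..<t} (\<lambda>_. state_action_space P)"
  have \<kappa>: "transition P a \<in> state_space P \<rightarrow>\<^sub>M prob_algebra (state_space P)" for a
    using P by (simp add: discounted_project_def)
  have p[measurable]: "\<pi> t \<in> (?H \<Otimes>\<^sub>M state_space P) \<rightarrow>\<^sub>M prob_algebra action_space"
    using \<pi> by (simp add: policies_def)
  have 1: "state_law P x t \<in> ?H \<rightarrow>\<^sub>M prob_algebra (state_space P)"
  proof (cases t)
    case 0
    have "return (state_space P) x \<in> space (prob_algebra (state_space P))"
      using x by (auto simp: space_prob_algebra intro!: prob_space_return)
    then show ?thesis using 0 by (simp add: state_law_def[abs_def])
  next
    case (Suc n)
    have c: "(\<lambda>h. h n) \<in> ?H \<rightarrow>\<^sub>M state_space P \<Otimes>\<^sub>M count_space UNIV"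
      using measurable_component_singleton[of n "{0..<t}" "\<lambda>_. state_action_space P"] Suc
      by (simp add: state_action_space_def action_space_def)
    have "(\<lambda>p. transition P (snd p) (fst p)) \<in>
      state_space P \<Otimes>\<^sub>M count_space UNIV \<rightarrow>\<^sub>M prob_algebra (state_space P)"
      by (rule measurable_compose_countable'[where I = UNIV])
         (auto intro: measurable_compose[OF measurable_fst \<kappa>])
    from measurable_compose[OF c this] show ?thesis
      using Suc by (simp add: state_law_def[abs_def])
  qed
  have 2: "(\<lambda>(h, y). \<pi> t (h, y) \<bind> (\<lambda>a. return (state_action_space P) (y, a)))
     \<in> (?H \<Otimes>\<^sub>M state_space P) \<rightarrow>\<^sub>M prob_algebra (state_action_space P)"
    unfolding case_prod_beta prod.collapse
  proof (rule measurable_bind_prob_space2[where N = action_space])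
    show "\<pi> t \<in> (?H \<Otimes>\<^sub>M state_space P) \<rightarrow>\<^sub>M prob_algebra action_space" by (rule p)
    have "(\<lambda>q. (snd (fst q), snd q)) \<in>
        (?H \<Otimes>\<^sub>M state_space P) \<Otimes>\<^sub>M action_space \<rightarrow>\<^sub>M state_action_space P"
      unfolding state_action_space_def by measurable
    from measurable_compose[OF this measurable_return_prob_space]
    show "(\<lambda>(q, a). return (state_action_space P) (snd q, a)) \<in>
        (?H \<Otimes>\<^sub>M state_space P) \<Otimes>\<^sub>M action_space \<rightarrow>\<^sub>M prob_algebra (state_action_space P)"
      by (simp add: case_prod_beta)
  qed
  show ?thesis
    unfolding step_law_def[abs_def]
    by (rule measurable_bind_prob_space2[OF 1]) (use 2 in simp)
qed

lemma Ionescu_Tulcea_step_law: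
  assumes "discounted_project P" and "\<pi> \<in> policies P" and "x \<in> states P"
  shows "Ionescu_Tulcea (step_law P \<pi> x) (\<lambda>_. state_action_space P)"
proof (rule Ionescu_Tulcea.intro)
  note m = step_law_measurable[OF assms]
  fix t :: nat
  show "step_law P \<pi> x t \<in>
      PiM {0..<t} (\<lambda>_. state_action_space P) \<rightarrow>\<^sub>M subprob_algebra (state_action_space P)"
    by (rule measurable_prob_algebraD[OF m])
next
  note m = step_law_measurable[OF assms]
  fix t :: nat and h assume "h \<in> space (PiM {0..<t} (\<lambda>_. state_action_space P))"
  then show "prob_space (step_law P \<pi> x t h)"
    using measurable_space[OF m[of t]] by (auto simp: space_prob_algebra)
qed

lemma prob_space_trajectory_law:
  assumes "discounted_project P" and "\<pi> \<in> policies P" and "x \<in> states P"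
  shows "prob_space (trajectory_law P \<pi> x)"
    and "sets (trajectory_law P \<pi> x) = sets (PiM UNIV (\<lambda>_. state_action_space P))"
proof -
  interpret Ionescu_Tulcea "step_law P \<pi> x" "\<lambda>_. state_action_space P"
    by (rule Ionescu_Tulcea_step_law[OF assms])
  show "prob_space (trajectory_law P \<pi> x)"
  proof (rule prob_spaceI)
    have "emeasure PF.lim (PF.emb UNIV {} {\<lambda>_. undefined}) = emeasure (CI {}) {\<lambda>_. undefined}"
      by (rule lim) (auto simp: PiM_empty)
    moreover have "emeasure (CI {}) {\<lambda>_. undefined} = 1"
      using prob_space.emeasure_space_1[OF PF.prob_space_P, of "{}"] by (simp add: PF.space_P PiM_empty)
    ultimately show "emeasure (trajectory_law P \<pi> x) (space (trajectory_law P \<pi> x)) = 1"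
      by (simp add: trajectory_law_def prod_emb_def PiM_empty space_PiM PiE_UNIV_domain restrict_def)
  qed
  show "sets (trajectory_law P \<pi> x) = sets (PiM UNIV (\<lambda>_. state_action_space P))"
    by (simp add: trajectory_law_def)
qed

lemma threshold_policy_in_policies: "threshold_policy z \<in> policies P"
proof -
  have "(\<lambda>x. z < ereal x) \<in> state_space P \<rightarrow>\<^sub>M action_space"
    unfolding state_space_def action_space_def
    by (rule measurable_restrict_space1) measurable
  then show ?thesis
    unfolding policies_def threshold_policy_def case_prod_beta
    by (auto intro!: measurable_compose[OF _ measurable_return_prob_space]
        intro: measurable_compose[OF measurable_snd])
qed

lemma threshold_policy_left_in_policies: "threshold_policy_left z \<in> policies P"
proof -
  have "(\<lambda>x. z \<le> ereal x) \<in> state_space P \<rightarrow>\<^sub>M action_space"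
    unfolding state_space_def action_space_def
    by (rule measurable_restrict_space1) measurable
  then show ?thesis
    unfolding policies_def threshold_policy_left_def case_prod_beta
    by (auto intro!: measurable_compose[OF _ measurable_return_prob_space]
        intro: measurable_compose[OF measurable_snd])
qed

lemma action_then_in_policies:
  assumes "\<pi> \<in> policies P" shows "action_then a \<pi> \<in> policies P"
  unfolding policies_def
proof (safe)
  fix t :: nat
  let ?S = "\<lambda>t. PiM {0..<t} (\<lambda>_. state_action_space P) \<Otimes>\<^sub>M state_space P"
  show "action_then a \<pi> t \<in> ?S t \<rightarrow>\<^sub>M prob_algebra action_space"
  proof (cases t)
    case 0
    then show ?thesis
      by (auto simp: action_then_def case_prod_beta
          intro!: measurable_compose[OF _ measurable_return_prob_space] measurable_const)
  next
    case (Suc n)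
    have p: "\<pi> n \<in> ?S n \<rightarrow>\<^sub>M prob_algebra action_space"
      using assms by (simp add: policies_def)
    have "(\<lambda>q. (\<lambda>i\<in>{0..<n}. fst q (Suc i), snd q)) \<in> ?S t \<rightarrow>\<^sub>M ?S n"
      using Suc by (intro measurable_Pair measurable_restrict
          measurable_compose[OF measurable_fst measurable_component_singleton] measurable_snd) auto
    from measurable_compose[OF this p] show ?thesis
      using Suc by (simp add: action_then_def case_prod_beta)
  qed
qed

end

theory Submission
  imports Defs
begin

text \<open>
  Fix the price \<open>\<lambda> = \<lambda>\<^sup>*(x)\<close>. Thresholdability forces the Whittle index to be
  nondecreasing, so the action gap at this price is nonnegative above \<open>x\<close>, nonpositive below
  \<open>x\<close> and zero at \<open>x\<close>: both threshold policies at \<open>x\<close> are greedy for the optimal value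
  function. The value of taking action \<open>a\<close> first and following such a policy afterwards is
  therefore the action value of \<open>a\<close> at \<open>x\<close>, and the difference of the two action values,
  \<open>f - \<lambda> g\<close>, is the action gap at \<open>x\<close>, which vanishes. That greedy policies are optimal is
  proved through a measurable fixed point of the Bellman operator, the limit of value
  iteration in the weighted supremum norm.
\<close>

section \<open>Finite-dimensional marginals of the Ionescu-Tulcea limit\<close>

text \<open>The preimage of \<open>A\<close> is a cylinder, and the projective limit evaluates
  cylinders through \<open>CI\<close>. With \<open>{0..<n}\<close> as index set, \<open>CI\<close>
  is computed by \<open>C 0 n\<close>, and embedding \<open>A\<close> into its own index set changes
  nothing.\<close>

lemma (in Ionescu_Tulcea) distr_lim_restrict:
  "distr PF.lim (PiM {0..<n} M) (\<lambda>\<omega>. restrict \<omega> {0..<n}) = C 0 n (\<lambda>_. undefined)"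
proof (rule measure_eqI)
  have [measurable]: "(\<lambda>\<omega>. restrict \<omega> {0..<n}) \<in> PF.lim \<rightarrow>\<^sub>M PiM {0..<n} M"
    by (simp add: measurable_cong_sets[OF PF.sets_lim refl] measurable_restrict_subset)
  fix A assume "A \<in> sets (distr PF.lim (PiM {0..<n} M) (\<lambda>\<omega>. restrict \<omega> {0..<n}))"
  then have A[measurable]: "A \<in> sets (PiM {0..<n} M)"
    by simp
  have "emeasure (distr PF.lim (PiM {0..<n} M) (\<lambda>\<omega>. restrict \<omega> {0..<n})) A
      = emeasure PF.lim (PF.emb UNIV {0..<n} A)"
    by (subst emeasure_distr) (auto simp: prod_emb_def space_PiM)
  also have "\<dots> = emeasure (C 0 n (\<lambda>_. undefined)) (PF.emb {0..<n} {0..<n} A)"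
    by (simp add: lim emeasure_CI)
  also have "PF.emb {0..<n} {0..<n} A = A"
    by (rule prod_emb_id) (rule sets.sets_into_space[OF A, unfolded space_PiM])
  finally show "emeasure (distr PF.lim (PiM {0..<n} M) (\<lambda>\<omega>. restrict \<omega> {0..<n})) A
      = emeasure (C 0 n (\<lambda>_. undefined)) A" .
qed (simp add: sets_C)

text \<open>This identifies \<open>P n\<close> as the conditional law of coordinate \<open>n\<close>
  given the earlier ones: both sides reduce to finite horizons, where \<open>C 0 (Suc n)\<close> is
  \<open>C 0 n\<close> followed by one extension step.\<close>

lemma (in Ionescu_Tulcea) nn_integral_lim_component:
  assumes [measurable]: "f \<in> borel_measurable (M n)"
  shows "(\<integral>\<^sup>+\<omega>. f (\<omega> n) \<partial>PF.lim) = (\<integral>\<^sup>+\<omega>. (\<integral>\<^sup>+s. f s \<partial>P n (restrict \<omega> {0..<n})) \<partial>PF.lim)"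
proof -
  have m[measurable]: "(\<lambda>\<omega>. restrict \<omega> {0..<k}) \<in> PF.lim \<rightarrow>\<^sub>M PiM {0..<k} M" for k
    by (simp add: measurable_cong_sets[OF PF.sets_lim refl] measurable_restrict_subset)
  have g: "(\<lambda>h. f (h n)) \<in> borel_measurable (PiM {0..<Suc n} M)"
    by measurable
  have "(\<integral>\<^sup>+\<omega>. f (\<omega> n) \<partial>PF.lim) = (\<integral>\<^sup>+h. f (h n) \<partial>C 0 (Suc n) (\<lambda>_. undefined))"
    unfolding distr_lim_restrict[symmetric] by (subst nn_integral_distr) (auto intro: g)
  also have "\<dots> = (\<integral>\<^sup>+h. (\<integral>\<^sup>+h'. f (h' n) \<partial>eP n h) \<partial>C 0 n (\<lambda>_. undefined))"
    unfolding C.simps add_0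
    by (rule nn_integral_bind[OF g], subst measurable_cong_sets[OF sets_C refl]) auto
  \<comment> \<open>\<open>eP n h\<close> extends \<open>h\<close> by a new coordinate
    \<open>n\<close> drawn from \<open>P n h\<close>, and \<open>f (h' n)\<close> sees only this
    coordinate.\<close>
  also have "\<dots> = (\<integral>\<^sup>+h. (\<integral>\<^sup>+s. f s \<partial>P n h) \<partial>C 0 n (\<lambda>_. undefined))"
    by (intro nn_integral_cong) (simp add: space_C nn_integral_eP g)
  also have "\<dots> = (\<integral>\<^sup>+\<omega>. (\<integral>\<^sup>+s. f s \<partial>P n (restrict \<omega> {0..<n})) \<partial>PF.lim)"
    unfolding distr_lim_restrict[symmetric] by (subst nn_integral_distr) auto
  finally show ?thesis .
qed

section \<open>Integration against the one-step law\<close>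

text \<open>The action factor is countable and discrete, so a function of the pair is measurable as
  soon as its section for each action is.\<close>

lemma measurable_state_action_space:
  assumes "\<And>a. (\<lambda>x. f (x, a)) \<in> state_space P \<rightarrow>\<^sub>M N"
  shows "f \<in> state_action_space P \<rightarrow>\<^sub>M N"
proof -
  have "(\<lambda>p. f (fst p, snd p)) \<in> state_space P \<Otimes>\<^sub>M count_space UNIV \<rightarrow>\<^sub>M N"
    by (rule measurable_compose_countable'[where I = UNIV])
       (auto intro: measurable_compose[OF measurable_fst assms])
  then show ?thesis
    by (simp add: state_action_space_def action_space_def)
qed

lemma space_state_action_space [simp]: "space (state_action_space P) = states P \<times> UNIV"
  by (simp add: state_action_space_def space_pair_measure)

lemma nn_integral_step_law:
  assumes P: "discounted_project P" and \<pi>: "\<pi> \<in> policies P" and x: "x \<in> states P"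
    and h: "h \<in> space (PiM {0..<t} (\<lambda>_. state_action_space P))"
    and f: "f \<in> borel_measurable (state_action_space P)"
  shows "(\<integral>\<^sup>+s. f s \<partial>step_law P \<pi> x t h)
    = (\<integral>\<^sup>+y. (\<integral>\<^sup>+a. f (y, a) \<partial>\<pi> t (h, y)) \<partial>state_law P x t h)"
proof -
  have \<kappa>: "transition P a \<in> state_space P \<rightarrow>\<^sub>M prob_algebra (state_space P)" for a
    using P by (simp add: discounted_project_def)
  have "state_law P x t h \<in> space (prob_algebra (state_space P))"
  proof (cases t)
    case 0
    then show ?thesis
      using x by (auto simp: state_law_def space_prob_algebra intro!: prob_space_return)
  next
    case (Suc n)
    then have "h n \<in> states P \<times> UNIV"
      using h by (auto simp: space_PiM PiE_iff simp del: mem_Times_iff)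
    then show ?thesis
      using Suc measurable_space[OF \<kappa>, of "fst (h n)"] by (auto simp: state_law_def)
  qed
  then have sets: "sets (state_law P x t h) = sets (state_space P)"
    by (simp add: space_prob_algebra)
  then have sp: "space (state_law P x t h) = states P"
    by (metis sets_eq_imp_space_eq space_state_space)
  have p: "(\<lambda>y. \<pi> t (h, y)) \<in> state_space P \<rightarrow>\<^sub>M prob_algebra action_space"
    using \<pi> measurable_compose[OF measurable_Pair1'[OF h]] by (auto simp: policies_def)
  have b: "(\<lambda>y. \<pi> t (h, y) \<bind> (\<lambda>a. return (state_action_space P) (y, a)))
      \<in> state_space P \<rightarrow>\<^sub>M prob_algebra (state_action_space P)"
  proof (rule measurable_bind_prob_space2[OF p])
    have "(\<lambda>q. q) \<in> state_space P \<Otimes>\<^sub>M action_space \<rightarrow>\<^sub>M state_action_space P"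
      unfolding state_action_space_def by measurable
    from measurable_compose[OF this measurable_return_prob_space]
    show "(\<lambda>(y, a). return (state_action_space P) (y, a))
        \<in> state_space P \<Otimes>\<^sub>M action_space \<rightarrow>\<^sub>M prob_algebra (state_action_space P)"
      by (simp add: case_prod_beta)
  qed
  have "(\<integral>\<^sup>+s. f s \<partial>step_law P \<pi> x t h)
      = (\<integral>\<^sup>+y. (\<integral>\<^sup>+s. f s \<partial>(\<pi> t (h, y) \<bind> (\<lambda>a. return (state_action_space P) (y, a)))) \<partial>state_law P x t h)"
    unfolding step_law_def
    by (intro nn_integral_bind[OF f])
       (simp add: measurable_cong_sets[OF sets refl] measurable_prob_algebraD[OF b])
  also have "\<dots> = (\<integral>\<^sup>+y. (\<integral>\<^sup>+a. f (y, a) \<partial>\<pi> t (h, y)) \<partial>state_law P x t h)"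
  proof (rule nn_integral_cong)
    fix y assume "y \<in> space (state_law P x t h)"
    then have y: "y \<in> states P" by (simp add: sp)
    have s: "sets (\<pi> t (h, y)) = sets action_space"
      using measurable_space[OF p, of y] y by (simp add: space_prob_algebra)
    \<comment> \<open>The action space carries the discrete sigma-algebra, so measurability in
      \<open>a\<close> only requires the values to lie in the right space.\<close>
    have "return (state_action_space P) (y, a) \<in> space (subprob_algebra (state_action_space P))" for a
      using y by (simp add: space_subprob_algebra subprob_space_return)
    then have "(\<lambda>a. return (state_action_space P) (y, a)) \<in> \<pi> t (h, y) \<rightarrow>\<^sub>M subprob_algebra (state_action_space P)"
      unfolding measurable_cong_sets[OF s refl] action_space_def by simp
    then show "(\<integral>\<^sup>+s. f s \<partial>(\<pi> t (h, y) \<bind> (\<lambda>a. return (state_action_space P) (y, a)))) = (\<integral>\<^sup>+a. f (y, a) \<partial>\<pi> t (h, y))"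
      using y f by (simp add: nn_integral_bind[OF f] nn_integral_return)
  qed
  finally show ?thesis .
qed

section \<open>The weighted norm and the one-step drift\<close>

locale weighted_project =
  fixes P :: project and w :: "real \<Rightarrow> real" and M \<gamma> :: real
  assumes discounted: "discounted_project P"
    and weighted: "weight_condition P w M \<gamma>"
begin

text \<open>
  If \<open>\<beta> = 0\<close>, the drift condition does not make \<open>w\<close> integrable; the lemmas below
  only use \<open>\<beta> * \<integral>w\<close>, and those stating integrability assume \<open>\<beta> \<noteq> 0\<close>.
\<close>

abbreviation "\<beta> \<equiv> discount P"
abbreviation "\<kappa> \<equiv> transition P"

lemma discount_nonneg: "0 \<le> \<beta>"
  using discounted by (auto simp: discounted_project_def)

lemma rate_nonneg: "0 \<le> \<gamma>" and rate_less_1: "\<gamma> < 1"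
  using weighted discount_nonneg by (auto simp: weight_condition_def)

lemma bound_pos: "0 < M"
  using weighted by (auto simp: weight_condition_def)

lemma weight_measurable [measurable]: "w \<in> borel_measurable (state_space P)"
  using weighted by (auto simp: weight_condition_def)

lemma weight_ge_1: "x \<in> states P \<Longrightarrow> 1 \<le> w x"
  using weighted by (auto simp: weight_condition_def)

lemma weight_nonneg: "x \<in> states P \<Longrightarrow> 0 \<le> w x"
  using weight_ge_1[of x] by simp

lemma reward_bound: "x \<in> states P \<Longrightarrow> \<bar>reward P x a\<bar> \<le> M * w x"
  and resource_bound: "x \<in> states P \<Longrightarrow> \<bar>resource P x a\<bar> \<le> M * w x"
proof -
  assume x: "x \<in> states P"
  have b: "max \<bar>reward P x a\<bar> (resource P x a) \<le> M * w x"
    using weighted x by (auto simp: weight_condition_def)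
  \<comment> \<open>The weight condition bounds the resource only from above; the absolute value is
    controlled through nonnegativity, which for the active action follows from the passive
    one.\<close>
  have "0 \<le> resource P x False \<and> resource P x False < resource P x True"
    using discounted x by (auto simp: discounted_project_def)
  then have "0 \<le> resource P x a"
    by (cases a) auto
  with b show "\<bar>reward P x a\<bar> \<le> M * w x" "\<bar>resource P x a\<bar> \<le> M * w x"
    by auto
qed

lemma transition_measurable [measurable]:
  "\<kappa> a \<in> state_space P \<rightarrow>\<^sub>M prob_algebra (state_space P)"
  using discounted by (auto simp: discounted_project_def)

lemma
  assumes "x \<in> states P"
  shows sets_transition: "sets (\<kappa> a x) = sets (state_space P)"
    and space_transition: "space (\<kappa> a x) = states P"
    and prob_space_transition: "prob_space (\<kappa> a x)"
proof -
  have "\<kappa> a x \<in> space (prob_algebra (state_space P))"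
    using measurable_space[OF transition_measurable] assms by simp
  then show "sets (\<kappa> a x) = sets (state_space P)" "prob_space (\<kappa> a x)"
    by (auto simp: space_prob_algebra)
  from sets_eq_imp_space_eq[OF this(1)] show "space (\<kappa> a x) = states P"
    by simp
qed

lemma weight_drift:
  "x \<in> states P \<Longrightarrow> ennreal \<beta> * (\<integral>\<^sup>+ y. ennreal (w y) \<partial>\<kappa> a x) \<le> ennreal (\<gamma> * w x)"
  using weighted by (auto simp: weight_condition_def)

lemma reward_measurable:
  "(\<lambda>s. reward P (fst s) (snd s)) \<in> borel_measurable (state_action_space P)"
  using discounted
  by (intro measurable_state_action_space)
     (auto simp: discounted_project_def state_space_def intro!: borel_measurable_continuous_on_restrict)

lemma resource_measurable:
  "(\<lambda>s. resource P (fst s) (snd s)) \<in> borel_measurable (state_action_space P)"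
  using discounted
  by (intro measurable_state_action_space)
     (auto simp: discounted_project_def state_space_def intro!: borel_measurable_continuous_on_restrict)

text \<open>The measurable part of the ball of radius \<open>K\<close> in the supremum norm weighted
  by \<open>w\<close>. The radius is explicit so that its change under the Bellman operator can be
  tracked.\<close>

definition weight_bounded :: "real \<Rightarrow> (real \<Rightarrow> real) \<Rightarrow> bool" where
  "weight_bounded K v \<longleftrightarrow> v \<in> borel_measurable (state_space P) \<and> (\<forall>y\<in>states P. \<bar>v y\<bar> \<le> K * w y)"

lemma weight_bounded_measurable: "weight_bounded K v \<Longrightarrow> v \<in> borel_measurable (state_space P)"
  by (simp add: weight_bounded_def)

lemma integrable_weight:
  assumes x: "x \<in> states P" and "\<beta> \<noteq> 0"
  shows "integrable (\<kappa> a x) w"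
proof (rule integrableI_nonneg)
  show "w \<in> borel_measurable (\<kappa> a x)"
    by (simp add: measurable_cong_sets[OF sets_transition[OF x] refl])
  show "AE y in \<kappa> a x. 0 \<le> w y"
    by (rule AE_I2) (simp add: space_transition[OF x] weight_nonneg)
  have "ennreal \<beta> * (\<integral>\<^sup>+ y. ennreal (w y) \<partial>\<kappa> a x) < \<infinity>"
    using weight_drift[OF x, of a] by (simp add: order_le_less_trans)
  then show "(\<integral>\<^sup>+ y. ennreal (w y) \<partial>\<kappa> a x) < \<infinity>"
    using assms(2) discount_nonneg by (auto simp: ennreal_mult_less_top)
qed

lemma integrable_weight_bounded:
  assumes x: "x \<in> states P" and "\<beta> \<noteq> 0" and v: "weight_bounded K v"
  shows "integrable (\<kappa> a x) v"
proof (rule Bochner_Integration.integrable_bound)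
  show "integrable (\<kappa> a x) (\<lambda>y. K * w y)"
    using integrable_weight[OF x] assms(2) by simp
  show "v \<in> borel_measurable (\<kappa> a x)"
    using v by (simp add: measurable_cong_sets[OF sets_transition[OF x] refl] weight_bounded_def)
  show "AE y in \<kappa> a x. norm (v y) \<le> norm (K * w y)"
    using v by (intro AE_I2) (auto simp: space_transition[OF x] weight_bounded_def intro: order_trans)
qed

lemma expected_weight_le:
  assumes x: "x \<in> states P"
  shows "\<beta> * (\<integral>y. w y \<partial>\<kappa> a x) \<le> \<gamma> * w x"
proof (cases "\<beta> = 0")
  case False
  have "ennreal (\<beta> * (\<integral>y. w y \<partial>\<kappa> a x)) = ennreal \<beta> * (\<integral>\<^sup>+ y. ennreal (w y) \<partial>\<kappa> a x)"
    by (subst nn_integral_eq_integral)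
       (auto simp: integrable_weight[OF x False] space_transition[OF x] weight_nonneg
          ennreal_mult' discount_nonneg)
  also have "\<dots> \<le> ennreal (\<gamma> * w x)"
    by (rule weight_drift[OF x])
  finally show ?thesis
    using rate_nonneg weight_nonneg[OF x] by (simp add: ennreal_le_iff)
qed (use rate_nonneg weight_nonneg[OF x] in simp)

lemma weight_bounded_nonneg:
  assumes "x \<in> states P" and "weight_bounded K v"
  shows "0 \<le> K"
proof -
  have "0 \<le> K * w x" using assms by (force simp: weight_bounded_def intro: order_trans[OF abs_ge_zero])
  then show ?thesis using weight_ge_1[OF assms(1)] by (simp add: zero_le_mult_iff)
qed

text \<open>The source of the contraction: by the drift condition, one discounted transition
  multiplies the weighted radius by \<open>\<gamma>\<close>. The case \<open>\<beta> = 0\<close> is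
  separate because \<open>w\<close> may then fail to be integrable.\<close>

lemma expectation_bound:
  assumes x: "x \<in> states P" and v: "weight_bounded K v"
  shows "\<bar>\<beta> * (\<integral>y. v y \<partial>\<kappa> a x)\<bar> \<le> K * \<gamma> * w x"
proof (cases "\<beta> = 0")
  case False
  have "\<bar>\<integral>y. v y \<partial>\<kappa> a x\<bar> \<le> (\<integral>y. \<bar>v y\<bar> \<partial>\<kappa> a x)"
    by (rule integral_abs_bound)
  also have "\<dots> \<le> (\<integral>y. K * w y \<partial>\<kappa> a x)"
    using v by (intro integral_mono)
       (auto simp: integrable_weight_bounded[OF x False v] integrable_weight[OF x False]
          space_transition[OF x] weight_bounded_def)
  finally have "\<bar>\<beta> * (\<integral>y. v y \<partial>\<kappa> a x)\<bar> \<le> \<beta> * (K * (\<integral>y. w y \<partial>\<kappa> a x))"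
    using discount_nonneg by (simp add: abs_mult mult_left_mono)
  also have "\<dots> = K * (\<beta> * (\<integral>y. w y \<partial>\<kappa> a x))"
    by simp
  also have "\<dots> \<le> K * (\<gamma> * w x)"
    by (intro mult_left_mono expected_weight_le x weight_bounded_nonneg[OF x v])
  finally show ?thesis by (simp add: ac_simps)
qed (use rate_nonneg weight_nonneg[OF x] weight_bounded_nonneg[OF x v] in simp)

lemma expectation_measurable:
  fixes v :: "real \<Rightarrow> real"
  assumes "v \<in> borel_measurable (state_space P)"
  shows "(\<lambda>s. \<integral>y. v y \<partial>\<kappa> (snd s) (fst s)) \<in> borel_measurable (state_action_space P)"
  by (intro measurable_state_action_space)
     (auto intro: measurable_compose[OF measurable_prob_algebraD[OF transition_measurable]
        integral_measurable_subprob_algebra[OF assms]])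

lemma nn_expectation_measurable:
  fixes v :: "real \<Rightarrow> ennreal"
  assumes "v \<in> borel_measurable (state_space P)"
  shows "(\<lambda>s. \<integral>\<^sup>+y. v y \<partial>\<kappa> (snd s) (fst s)) \<in> borel_measurable (state_action_space P)"
  by (intro measurable_state_action_space)
     (auto intro: measurable_compose[OF measurable_prob_algebraD[OF transition_measurable]
        nn_integral_measurable_subprob_algebra[OF assms]])

section \<open>Disintegration of the trajectory law\<close>

context
  fixes \<pi> x
  assumes \<pi>: "\<pi> \<in> policies P" and x: "x \<in> states P"
begin

abbreviation "\<mu> \<equiv> trajectory_law P \<pi> x"

lemma component_measurable: "(\<lambda>\<omega>. \<omega> t) \<in> \<mu> \<rightarrow>\<^sub>M state_action_space P"
  unfolding measurable_cong_sets[OF prob_space_trajectory_law(2)[OF discounted \<pi> x] refl]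
  by (rule measurable_component_singleton) simp

lemma space_trajectory: "\<omega> \<in> space \<mu> \<Longrightarrow> fst (\<omega> t) \<in> states P"
  using measurable_space[OF component_measurable, of \<omega> t] by (auto simp: mem_Times_iff)

lemma fst_component_measurable: "(\<lambda>\<omega>. fst (\<omega> t)) \<in> \<mu> \<rightarrow>\<^sub>M state_space P"
  using component_measurable
  unfolding state_action_space_def by (rule measurable_compose[OF _ measurable_fst])

lemma restrict_trajectory:
  "\<omega> \<in> space \<mu> \<Longrightarrow> restrict \<omega> {0..<t} \<in> space (PiM {0..<t} (\<lambda>_. state_action_space P))"
  using sets_eq_imp_space_eq[OF prob_space_trajectory_law(2)[OF discounted \<pi> x]]
  by (auto simp: space_PiM PiE_iff)

lemma nn_integral_component:
  assumes f: "f \<in> borel_measurable (state_action_space P)"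
  shows "(\<integral>\<^sup>+\<omega>. f (\<omega> t) \<partial>\<mu>) = (\<integral>\<^sup>+\<omega>. (\<integral>\<^sup>+y. (\<integral>\<^sup>+a. f (y, a) \<partial>\<pi> t (restrict \<omega> {0..<t}, y))
    \<partial>state_law P x t (restrict \<omega> {0..<t})) \<partial>\<mu>)"
proof -
  interpret IT: Ionescu_Tulcea "step_law P \<pi> x" "\<lambda>_. state_action_space P"
    by (rule Ionescu_Tulcea_step_law[OF discounted \<pi> x])
  have "(\<integral>\<^sup>+\<omega>. f (\<omega> t) \<partial>\<mu>) = (\<integral>\<^sup>+\<omega>. (\<integral>\<^sup>+s. f s \<partial>step_law P \<pi> x t (restrict \<omega> {0..<t})) \<partial>\<mu>)"
    unfolding trajectory_law_def by (rule IT.nn_integral_lim_component[OF f])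
  also have "\<dots> = (\<integral>\<^sup>+\<omega>. (\<integral>\<^sup>+y. (\<integral>\<^sup>+a. f (y, a) \<partial>\<pi> t (restrict \<omega> {0..<t}, y))
    \<partial>state_law P x t (restrict \<omega> {0..<t})) \<partial>\<mu>)"
    by (intro nn_integral_cong nn_integral_step_law[OF discounted \<pi> x _ f] restrict_trajectory)
  finally show ?thesis .
qed

lemma prob_space_policy:
  assumes "\<omega> \<in> space \<mu>" and "y \<in> states P"
  shows "prob_space (\<pi> t (restrict \<omega> {0..<t}, y))"
proof -
  have "\<pi> t (restrict \<omega> {0..<t}, y) \<in> space (prob_algebra action_space)"
    using \<pi> restrict_trajectory[OF assms(1), of t] assms(2)
    by (auto simp: policies_def space_pair_measure intro!: measurable_space[of "\<pi> t"])
  then show ?thesis by (simp add: space_prob_algebra)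
qed

lemma space_state_law:
  assumes "\<omega> \<in> space \<mu>"
  shows "space (state_law P x t (restrict \<omega> {0..<t})) = states P"
  using space_transition space_trajectory[OF assms]
  by (cases t) (auto simp: state_law_def)

text \<open>The action integrates out, because every action law returned by the policy has total
  mass one.\<close>

lemma nn_integral_state:
  assumes f: "f \<in> borel_measurable (state_space P)"
  shows "(\<integral>\<^sup>+\<omega>. f (fst (\<omega> t)) \<partial>\<mu>)
    = (\<integral>\<^sup>+\<omega>. (\<integral>\<^sup>+y. f y \<partial>state_law P x t (restrict \<omega> {0..<t})) \<partial>\<mu>)"
proof -
  have "(\<lambda>s. f (fst s)) \<in> borel_measurable (state_action_space P)"
    by (intro measurable_state_action_space) (simp add: f)
  from nn_integral_component[OF this] have
    "(\<integral>\<^sup>+\<omega>. f (fst (\<omega> t)) \<partial>\<mu>) = (\<integral>\<^sup>+\<omega>. (\<integral>\<^sup>+y. (\<integral>\<^sup>+a. f y \<partial>\<pi> t (restrict \<omega> {0..<t}, y))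
      \<partial>state_law P x t (restrict \<omega> {0..<t})) \<partial>\<mu>)"
    by simp
  also have "\<dots> = (\<integral>\<^sup>+\<omega>. (\<integral>\<^sup>+y. f y \<partial>state_law P x t (restrict \<omega> {0..<t})) \<partial>\<mu>)"
    by (intro nn_integral_cong)
       (simp add: space_state_law prob_space_policy prob_space.emeasure_space_1)
  finally show ?thesis .
qed

lemma nn_integral_initial:
  assumes f: "f \<in> borel_measurable (state_space P)"
  shows "(\<integral>\<^sup>+\<omega>. f (fst (\<omega> 0)) \<partial>\<mu>) = f x"
  using x prob_space.emeasure_space_1[OF prob_space_trajectory_law(1)[OF discounted \<pi> x]]
  by (simp add: nn_integral_state[OF f] state_law_def nn_integral_return f)

text \<open>The Markov property for nonnegative functions, valid for every history-dependent policy: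
  the next state law uses only the last pair of the history, and restricting to
  \<open>{0..<Suc t}\<close> keeps the pair of time \<open>t\<close>.\<close>

lemma nn_integral_next:
  assumes f: "f \<in> borel_measurable (state_space P)"
  shows "(\<integral>\<^sup>+\<omega>. f (fst (\<omega> (Suc t))) \<partial>\<mu>) = (\<integral>\<^sup>+\<omega>. (\<integral>\<^sup>+y. f y \<partial>\<kappa> (snd (\<omega> t)) (fst (\<omega> t))) \<partial>\<mu>)"
  by (simp add: nn_integral_state[OF f] state_law_def)

text \<open>The state law at time 0 is a point mass, so the indicator of the complement of
  \<open>{x}\<close> has expectation zero.\<close>

lemma AE_initial: "AE \<omega> in \<mu>. fst (\<omega> 0) = x"
proof -
  have m: "(\<lambda>y. indicator (- {x}) y :: ennreal) \<in> borel_measurable (state_space P)"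
    unfolding state_space_def by (rule measurable_restrict_space1) measurable
  have "(\<integral>\<^sup>+\<omega>. indicator (- {x}) (fst (\<omega> 0)) \<partial>\<mu>) = 0"
    by (simp add: nn_integral_initial[OF m])
  then have "AE \<omega> in \<mu>. indicator (- {x}) (fst (\<omega> 0)) = (0::ennreal)"
    by (subst (asm) nn_integral_0_iff_AE) (auto intro: measurable_compose[OF fst_component_measurable m])
  then show ?thesis by (auto simp: indicator_def)
qed

text \<open>The indicator of a deviation from \<open>d\<close> has expectation zero. The hypothesis
  concerns the single time \<open>t\<close>, so for \<open>action_then\<close> time 0 and the later
  times can be treated with different rules \<open>d\<close>.\<close>

lemma AE_action:
  assumes "\<And>h y. \<pi> t (h, y) = return action_space (d y)"
    and d: "d \<in> state_space P \<rightarrow>\<^sub>M action_space"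
  shows "AE \<omega> in \<mu>. snd (\<omega> t) = d (fst (\<omega> t))"
proof -
  let ?f = "\<lambda>s. if snd s = d (fst s) then 0 else 1 :: ennreal"
  have "{y \<in> states P. a = d y} \<in> sets (state_space P)" for a
    using measurable_sets[OF d, of "{a}"]
    by (simp add: action_space_def vimage_def Int_def conj_commute eq_commute)
  then have f: "?f \<in> borel_measurable (state_action_space P)"
    by (intro measurable_state_action_space) (auto intro!: measurable_If simp: pred_def)
  have "(\<integral>\<^sup>+\<omega>. ?f (\<omega> t) \<partial>\<mu>) = 0"
    unfolding nn_integral_component[OF f] assms(1)
    by (simp add: nn_integral_return action_space_def)
  then have "AE \<omega> in \<mu>. ?f (\<omega> t) = 0"
    by (subst (asm) nn_integral_0_iff_AE) (auto intro: measurable_compose[OF component_measurable f])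
  then show ?thesis by (auto split: if_splits)
qed

end

section \<open>Discounted expectations along a trajectory\<close>

lemma summable_rate: "summable (\<lambda>t. C * \<gamma> ^ t :: real)"
  using rate_nonneg rate_less_1 by (intro summable_mult summable_geometric) simp

context
  fixes \<pi> x
  assumes \<pi>: "\<pi> \<in> policies P" and x: "x \<in> states P"
begin

text \<open>Induction on \<open>t\<close>: conditioning on the pair at time \<open>t\<close> turns
  one factor \<open>\<beta>\<close> and the next weight into at most \<open>\<gamma>\<close> times
  the current weight. Nonnegative integrals are used because integrability of the weights is only a
  consequence of this bound.\<close>

lemma expected_discounted_weight_le:
  "(\<integral>\<^sup>+\<omega>. ennreal (\<beta> ^ t * w (fst (\<omega> t))) \<partial>\<mu> \<pi> x) \<le> ennreal (\<gamma> ^ t * w x)"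
proof (induction t)
  case 0
  have "(\<lambda>y. ennreal (w y)) \<in> borel_measurable (state_space P)"
    by simp
  from nn_integral_initial[OF \<pi> x this] show ?case by simp
next
  case (Suc t)
  note sp = space_trajectory[OF \<pi> x]
  have m: "(\<lambda>\<omega>. w (fst (\<omega> t))) \<in> borel_measurable (\<mu> \<pi> x)" for t
    by (rule measurable_compose[OF fst_component_measurable[OF \<pi> x] weight_measurable])
  have m': "(\<lambda>\<omega>. \<integral>\<^sup>+y. ennreal (w y) \<partial>\<kappa> (snd (\<omega> t)) (fst (\<omega> t))) \<in> borel_measurable (\<mu> \<pi> x)"
    by (rule measurable_compose[OF component_measurable[OF \<pi> x] nn_expectation_measurable]) simp
  have "(\<integral>\<^sup>+\<omega>. ennreal (\<beta> ^ Suc t * w (fst (\<omega> (Suc t)))) \<partial>\<mu> \<pi> x)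
      = ennreal (\<beta> ^ Suc t) * (\<integral>\<^sup>+\<omega>. ennreal (w (fst (\<omega> (Suc t)))) \<partial>\<mu> \<pi> x)"
    using discount_nonneg m by (simp add: ennreal_mult' nn_integral_cmult del: power_Suc)
  also have "\<dots> = ennreal (\<beta> ^ Suc t)
      * (\<integral>\<^sup>+\<omega>. (\<integral>\<^sup>+y. ennreal (w y) \<partial>\<kappa> (snd (\<omega> t)) (fst (\<omega> t))) \<partial>\<mu> \<pi> x)"
    by (subst nn_integral_next[OF \<pi> x]) auto
  also have "\<dots> = (\<integral>\<^sup>+\<omega>. ennreal (\<beta> ^ t)
      * (ennreal \<beta> * (\<integral>\<^sup>+y. ennreal (w y) \<partial>\<kappa> (snd (\<omega> t)) (fst (\<omega> t)))) \<partial>\<mu> \<pi> x)"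
    using discount_nonneg m'
    by (simp add: nn_integral_cmult ennreal_mult'' mult.assoc mult.left_commute[of "ennreal \<beta>"])
  also have "\<dots> \<le> (\<integral>\<^sup>+\<omega>. ennreal (\<beta> ^ t) * ennreal (\<gamma> * w (fst (\<omega> t))) \<partial>\<mu> \<pi> x)"
    by (intro nn_integral_mono mult_left_mono weight_drift sp) auto
  also have "\<dots> = (\<integral>\<^sup>+\<omega>. ennreal \<gamma> * ennreal (\<beta> ^ t * w (fst (\<omega> t))) \<partial>\<mu> \<pi> x)"
    using discount_nonneg rate_nonneg
    by (simp add: ennreal_mult'[symmetric] mult.left_commute)
  also have "\<dots> = ennreal \<gamma> * (\<integral>\<^sup>+\<omega>. ennreal (\<beta> ^ t * w (fst (\<omega> t))) \<partial>\<mu> \<pi> x)"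
    using m by (intro nn_integral_cmult) auto
  also have "\<dots> \<le> ennreal \<gamma> * ennreal (\<gamma> ^ t * w x)"
    by (intro mult_left_mono Suc) auto
  also have "\<dots> = ennreal (\<gamma> ^ Suc t * w x)"
    using rate_nonneg by (simp add: ennreal_mult'[symmetric] mult.assoc)
  finally show ?case .
qed

lemma
  shows integrable_discounted_weight: "integrable (\<mu> \<pi> x) (\<lambda>\<omega>. \<beta> ^ t * w (fst (\<omega> t)))" (is ?int)
    and discounted_weight_le: "(\<integral>\<omega>. \<beta> ^ t * w (fst (\<omega> t)) \<partial>\<mu> \<pi> x) \<le> \<gamma> ^ t * w x" (is ?le)
proof -
  have m: "(\<lambda>\<omega>. \<beta> ^ t * w (fst (\<omega> t))) \<in> borel_measurable (\<mu> \<pi> x)"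
    by (intro borel_measurable_times borel_measurable_const
        measurable_compose[OF fst_component_measurable[OF \<pi> x] weight_measurable])
  have nn: "AE \<omega> in \<mu> \<pi> x. 0 \<le> \<beta> ^ t * w (fst (\<omega> t))"
    by (intro AE_I2 mult_nonneg_nonneg zero_le_power discount_nonneg weight_nonneg
        space_trajectory[OF \<pi> x])
  show int: ?int
    using expected_discounted_weight_le[of t] by (intro integrableI_nonneg m nn) (auto intro: order_le_less_trans)
  show ?le
    using expected_discounted_weight_le[of t] rate_nonneg weight_nonneg[OF x]
    by (simp add: nn_integral_eq_integral[OF int nn])
qed

context
  fixes \<phi> :: "real \<times> bool \<Rightarrow> real" and K :: real
  assumes \<phi>: "\<phi> \<in> borel_measurable (state_action_space P)"
    and bound: "\<And>y a. y \<in> states P \<Longrightarrow> \<bar>\<phi> (y, a)\<bar> \<le> K * w y"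
begin

lemma discounted_component_bound:
  assumes "\<omega> \<in> space (\<mu> \<pi> x)"
  shows "\<bar>\<beta> ^ t * \<phi> (\<omega> t)\<bar> \<le> K * (\<beta> ^ t * w (fst (\<omega> t)))"
  using mult_left_mono[OF bound[OF space_trajectory[OF \<pi> x assms, of t], of "snd (\<omega> t)"], of "\<beta> ^ t"] discount_nonneg
  by (simp add: abs_mult ac_simps)

lemma integrable_discounted: "integrable (\<mu> \<pi> x) (\<lambda>\<omega>. \<beta> ^ t * \<phi> (\<omega> t))"
proof (rule Bochner_Integration.integrable_bound)
  show "integrable (\<mu> \<pi> x) (\<lambda>\<omega>. K * (\<beta> ^ t * w (fst (\<omega> t))))"
    by (rule integrable_mult_right, rule integrable_discounted_weight)
  show "(\<lambda>\<omega>. \<beta> ^ t * \<phi> (\<omega> t)) \<in> borel_measurable (\<mu> \<pi> x)"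
    by (intro borel_measurable_times borel_measurable_const
        measurable_compose[OF component_measurable[OF \<pi> x] \<phi>])
  show "AE \<omega> in \<mu> \<pi> x. norm (\<beta> ^ t * \<phi> (\<omega> t)) \<le> norm (K * (\<beta> ^ t * w (fst (\<omega> t))))"
    unfolding real_norm_def
    by (intro AE_I2 order_trans[OF discounted_component_bound abs_ge_self])
qed

lemma integral_abs_discounted_le:
  "(\<integral>\<omega>. \<bar>\<beta> ^ t * \<phi> (\<omega> t)\<bar> \<partial>\<mu> \<pi> x) \<le> K * w x * \<gamma> ^ t"
proof -
  \<comment> \<open>The bound at the initial state itself forces \<open>K\<close> to be nonnegative,
    since \<open>w x\<close> is at least 1.\<close>
  have "0 \<le> K * w x"
    using bound[OF x] by (force intro: order_trans[OF abs_ge_zero])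
  then have K: "0 \<le> K"
    using weight_ge_1[OF x] by (simp add: zero_le_mult_iff)
  have "(\<integral>\<omega>. \<bar>\<beta> ^ t * \<phi> (\<omega> t)\<bar> \<partial>\<mu> \<pi> x) \<le> (\<integral>\<omega>. K * (\<beta> ^ t * w (fst (\<omega> t))) \<partial>\<mu> \<pi> x)"
    by (intro integral_mono integrable_abs integrable_discounted integrable_mult_right
        integrable_discounted_weight discounted_component_bound)
  also have "\<dots> = K * (\<integral>\<omega>. \<beta> ^ t * w (fst (\<omega> t)) \<partial>\<mu> \<pi> x)"
    by (rule integral_mult_right_zero)
  also have "\<dots> \<le> K * (\<gamma> ^ t * w x)"
    by (intro mult_left_mono discounted_weight_le K)
  finally show ?thesis by (simp add: ac_simps)
qed

text \<open>The sum and the expectation may be exchanged because the expected absolute values are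
  dominated by a geometric series with ratio \<open>\<gamma>\<close>.\<close>

lemma sums_expected_discounted:
  "(\<lambda>t. \<integral>\<omega>. \<beta> ^ t * \<phi> (\<omega> t) \<partial>\<mu> \<pi> x) sums (\<integral>\<omega>. (\<Sum>t. \<beta> ^ t * \<phi> (\<omega> t)) \<partial>\<mu> \<pi> x)"
proof (rule sums_integral)
  show s: "summable (\<lambda>t. \<integral>\<omega>. norm (\<beta> ^ t * \<phi> (\<omega> t)) \<partial>\<mu> \<pi> x)"
  proof (rule summable_comparison_test_ev[OF _ summable_rate[of "K * w x"]])
    show "\<forall>\<^sub>F t in sequentially. norm (\<integral>\<omega>. norm (\<beta> ^ t * \<phi> (\<omega> t)) \<partial>\<mu> \<pi> x) \<le> K * w x * \<gamma> ^ t"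
      using integral_abs_discounted_le by (intro always_eventually allI) simp
  qed
  have m: "(\<lambda>\<omega>. ennreal \<bar>\<beta> ^ t * \<phi> (\<omega> t)\<bar>) \<in> borel_measurable (\<mu> \<pi> x)" for t
    using borel_measurable_integrable[OF integrable_discounted[of t]] by measurable
  \<comment> \<open>By monotone convergence the sum of absolute values has finite expectation, hence
    is finite almost everywhere.\<close>
  have "(\<integral>\<^sup>+\<omega>. (\<Sum>t. ennreal \<bar>\<beta> ^ t * \<phi> (\<omega> t)\<bar>) \<partial>\<mu> \<pi> x)
      = (\<Sum>t. \<integral>\<^sup>+\<omega>. ennreal \<bar>\<beta> ^ t * \<phi> (\<omega> t)\<bar> \<partial>\<mu> \<pi> x)"
    by (rule nn_integral_suminf[OF m])
  also have "\<dots> = (\<Sum>t. ennreal (\<integral>\<omega>. \<bar>\<beta> ^ t * \<phi> (\<omega> t)\<bar> \<partial>\<mu> \<pi> x))"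
    by (intro suminf_cong nn_integral_eq_integral integrable_abs integrable_discounted) simp
  also have "\<dots> \<noteq> \<infinity>"
    using s by (simp add: suminf_ennreal2)
  finally have "AE \<omega> in \<mu> \<pi> x. (\<Sum>t. ennreal \<bar>\<beta> ^ t * \<phi> (\<omega> t)\<bar>) \<noteq> \<infinity>"
    by (intro nn_integral_PInf_AE) (use m in auto)
  then show "AE \<omega> in \<mu> \<pi> x. summable (\<lambda>t. norm (\<beta> ^ t * \<phi> (\<omega> t)))"
    by eventually_elim (auto intro!: summable_suminf_not_top)
qed (rule integrable_discounted)

end

text \<open>The Markov property for signed \<open>v\<close>. It is known for nonnegative functions,
  so it is applied to \<open>v + K * w\<close> and to \<open>K * w\<close>, and the second identity
  is subtracted from the first. For \<open>\<beta> = 0\<close> both sides are zero.\<close>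

lemma integral_next:
  assumes v: "weight_bounded K v"
  shows "(\<integral>\<omega>. \<beta> ^ Suc t * v (fst (\<omega> (Suc t))) \<partial>\<mu> \<pi> x)
    = (\<integral>\<omega>. \<beta> ^ t * (\<beta> * (\<integral>y. v y \<partial>\<kappa> (snd (\<omega> t)) (fst (\<omega> t)))) \<partial>\<mu> \<pi> x)"
proof (cases "\<beta> = 0")
  case False
  note sp = space_trajectory[OF \<pi> x]
  define E where "E v s = (\<integral>y. v y \<partial>\<kappa> (snd s) (fst s))" for v :: "real \<Rightarrow> real" and s
  have int: "integrable (\<mu> \<pi> x) (\<lambda>\<omega>. v (fst (\<omega> (Suc t))))"
    and intE: "integrable (\<mu> \<pi> x) (\<lambda>\<omega>. E v (\<omega> t))"
    if v: "weight_bounded K v" for v K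
  proof -
    have "(\<lambda>s. v (fst s)) \<in> borel_measurable (state_action_space P)"
      by (intro measurable_state_action_space) (simp add: weight_bounded_measurable[OF v])
    from integrable_discounted[OF this, of K "Suc t"] v False
    show "integrable (\<mu> \<pi> x) (\<lambda>\<omega>. v (fst (\<omega> (Suc t))))"
      by (simp add: weight_bounded_def)
    have "E v \<in> borel_measurable (state_action_space P)"
      unfolding E_def by (rule expectation_measurable[OF weight_bounded_measurable[OF v]])
    \<comment> \<open>The drift controls only \<open>\<beta> * E v\<close>; the additional factor is
      carried along and then cancelled, \<open>\<beta>\<close> being nonzero here.\<close>
    then have "integrable (\<mu> \<pi> x) (\<lambda>\<omega>. \<beta> ^ t * (\<beta> * E v (\<omega> t)))"
      using expectation_bound[OF _ v]
      by (intro integrable_discounted[of _ "K * \<gamma>"] borel_measurable_times borel_measurable_const)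
         (assumption, simp add: E_def)
    then show "integrable (\<mu> \<pi> x) (\<lambda>\<omega>. E v (\<omega> t))"
      using False by simp
  qed
  have pos: "(\<integral>\<omega>. v (fst (\<omega> (Suc t))) \<partial>\<mu> \<pi> x) = (\<integral>\<omega>. E v (\<omega> t) \<partial>\<mu> \<pi> x)"
    if v: "weight_bounded K v" and nn: "\<And>y. y \<in> states P \<Longrightarrow> 0 \<le> v y" for v K
  proof -
    have E: "ennreal (E v (\<omega> t)) = (\<integral>\<^sup>+y. ennreal (v y) \<partial>\<kappa> (snd (\<omega> t)) (fst (\<omega> t)))"
      and E0: "0 \<le> E v (\<omega> t)"
      if "\<omega> \<in> space (\<mu> \<pi> x)" for \<omega>
    proof -
      have "AE y in \<kappa> (snd (\<omega> t)) (fst (\<omega> t)). 0 \<le> v y"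
        by (rule AE_I2) (simp add: space_transition[OF sp[OF that]] nn)
      then show "ennreal (E v (\<omega> t)) = (\<integral>\<^sup>+y. ennreal (v y) \<partial>\<kappa> (snd (\<omega> t)) (fst (\<omega> t)))"
        and "0 \<le> E v (\<omega> t)"
        unfolding E_def
        by (simp_all add: nn_integral_eq_integral integrable_weight_bounded[OF sp[OF that] False v]
            integral_nonneg_AE)
    qed
    have "ennreal (\<integral>\<omega>. v (fst (\<omega> (Suc t))) \<partial>\<mu> \<pi> x) = (\<integral>\<^sup>+\<omega>. ennreal (v (fst (\<omega> (Suc t)))) \<partial>\<mu> \<pi> x)"
      by (rule nn_integral_eq_integral[symmetric, OF int[OF v] AE_I2]) (simp add: nn sp)
    also have "\<dots> = (\<integral>\<^sup>+\<omega>. (\<integral>\<^sup>+y. ennreal (v y) \<partial>\<kappa> (snd (\<omega> t)) (fst (\<omega> t))) \<partial>\<mu> \<pi> x)"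
      using weight_bounded_measurable[OF v] by (intro nn_integral_next[OF \<pi> x]) simp
    also have "\<dots> = (\<integral>\<^sup>+\<omega>. ennreal (E v (\<omega> t)) \<partial>\<mu> \<pi> x)"
      by (intro nn_integral_cong) (simp add: E)
    also have "\<dots> = ennreal (\<integral>\<omega>. E v (\<omega> t) \<partial>\<mu> \<pi> x)"
      by (rule nn_integral_eq_integral[OF intE[OF v] AE_I2]) (rule E0)
    finally show ?thesis
      by (subst (asm) ennreal_inj) (auto intro!: integral_nonneg_AE simp: nn sp E0)
  qed
  have K: "0 \<le> K" by (rule weight_bounded_nonneg[OF x v])
  have w: "weight_bounded K (\<lambda>y. K * w y)"
    using K weight_nonneg by (auto simp: weight_bounded_def)
  \<comment> \<open>The shift by \<open>K * w\<close> makes \<open>v\<close> nonnegative on the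
    states at the cost of doubling the radius.\<close>
  have s: "weight_bounded (2 * K) (\<lambda>y. v y + K * w y)"
    unfolding weight_bounded_def
  proof (intro conjI ballI)
    show "(\<lambda>y. v y + K * w y) \<in> borel_measurable (state_space P)"
      using weight_bounded_measurable[OF v] by simp
    fix y assume "y \<in> states P"
    with v K weight_nonneg[of y] show "\<bar>v y + K * w y\<bar> \<le> 2 * K * w y"
      by (auto simp: weight_bounded_def abs_le_iff)
  qed
  have "(\<integral>\<omega>. v (fst (\<omega> (Suc t))) \<partial>\<mu> \<pi> x) + (\<integral>\<omega>. K * w (fst (\<omega> (Suc t))) \<partial>\<mu> \<pi> x)
      = (\<integral>\<omega>. v (fst (\<omega> (Suc t))) + K * w (fst (\<omega> (Suc t))) \<partial>\<mu> \<pi> x)"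
    by (rule Bochner_Integration.integral_add[symmetric, OF int[OF v] int[OF w]])
  also have "\<dots> = (\<integral>\<omega>. E (\<lambda>y. v y + K * w y) (\<omega> t) \<partial>\<mu> \<pi> x)"
    using v by (intro pos[OF s]) (auto simp: weight_bounded_def abs_le_iff)
  also have "\<dots> = (\<integral>\<omega>. E v (\<omega> t) + E (\<lambda>y. K * w y) (\<omega> t) \<partial>\<mu> \<pi> x)"
    unfolding E_def
    by (intro Bochner_Integration.integral_cong refl Bochner_Integration.integral_add
        integrable_weight_bounded[OF sp False v] integrable_weight_bounded[OF sp False w])
  also have "\<dots> = (\<integral>\<omega>. E v (\<omega> t) \<partial>\<mu> \<pi> x) + (\<integral>\<omega>. E (\<lambda>y. K * w y) (\<omega> t) \<partial>\<mu> \<pi> x)"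
    by (rule Bochner_Integration.integral_add[OF intE[OF v] intE[OF w]])
  also have "(\<integral>\<omega>. E (\<lambda>y. K * w y) (\<omega> t) \<partial>\<mu> \<pi> x) = (\<integral>\<omega>. K * w (fst (\<omega> (Suc t))) \<partial>\<mu> \<pi> x)"
    using K weight_nonneg by (intro pos[OF w, symmetric]) auto
  finally show ?thesis
    by (simp add: E_def mult.assoc)
qed simp

end

section \<open>The Bellman operator and value iteration\<close>

definition net_reward :: "real \<Rightarrow> real \<times> bool \<Rightarrow> real" where
  "net_reward lam s = reward P (fst s) (snd s) - lam * resource P (fst s) (snd s)"

text \<open>The counterpart of \<open>action_value\<close> with an arbitrary continuation
  \<open>v\<close> instead of \<open>optimal_value\<close>. It takes a pair so that it can be
  evaluated at a component of a trajectory.\<close>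

definition q_value :: "real \<Rightarrow> (real \<Rightarrow> real) \<Rightarrow> real \<times> bool \<Rightarrow> real" where
  "q_value lam v s = net_reward lam s + \<beta> * (\<integral>y. v y \<partial>\<kappa> (snd s) (fst s))"

definition bellman :: "real \<Rightarrow> (real \<Rightarrow> real) \<Rightarrow> real \<Rightarrow> real" where
  "bellman lam v x = max (q_value lam v (x, True)) (q_value lam v (x, False))"

lemma net_reward_measurable: "net_reward lam \<in> borel_measurable (state_action_space P)"
  unfolding net_reward_def
  by (intro borel_measurable_diff borel_measurable_times borel_measurable_const
      reward_measurable resource_measurable)

lemma net_reward_bound:
  assumes "x \<in> states P"
  shows "\<bar>net_reward lam (x, a)\<bar> \<le> M * (1 + \<bar>lam\<bar>) * w x"
proof -
  have "\<bar>net_reward lam (x, a)\<bar> \<le> \<bar>reward P x a\<bar> + \<bar>lam\<bar> * \<bar>resource P x a\<bar>"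
    unfolding net_reward_def by (simp add: abs_mult[symmetric])
  also have "\<dots> \<le> M * w x + \<bar>lam\<bar> * (M * w x)"
    by (intro add_mono mult_left_mono reward_bound resource_bound assms) simp
  finally show ?thesis by (simp add: algebra_simps)
qed

lemma q_value_measurable:
  assumes "weight_bounded K v"
  shows "q_value lam v \<in> borel_measurable (state_action_space P)"
  unfolding q_value_def
  by (intro borel_measurable_add borel_measurable_times borel_measurable_const
      net_reward_measurable expectation_measurable weight_bounded_measurable[OF assms])

lemma q_value_state_measurable:
  assumes "weight_bounded K v"
  shows "(\<lambda>x. q_value lam v (x, a)) \<in> borel_measurable (state_space P)"
proof -
  have "(\<lambda>x. (x, a)) \<in> state_space P \<rightarrow>\<^sub>M state_action_space P"
    unfolding state_action_space_def by (rule measurable_Pair2') simp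
  from measurable_compose[OF this q_value_measurable[OF assms]] show ?thesis .
qed

lemma q_value_bound:
  assumes "x \<in> states P" and "weight_bounded K v"
  shows "\<bar>q_value lam v (x, a)\<bar> \<le> (M * (1 + \<bar>lam\<bar>) + K * \<gamma>) * w x"
  using net_reward_bound[OF assms(1), of lam a] expectation_bound[OF assms, of a]
  unfolding q_value_def by (simp add: distrib_right)

text \<open>The net rewards cancel, so only the expectation of \<open>v - v'\<close> remains, and
  that contracts.\<close>

lemma q_value_diff:
  assumes x: "x \<in> states P" and v: "weight_bounded K v" and v': "weight_bounded K' v'"
    and d: "weight_bounded C (\<lambda>y. v y - v' y)"
  shows "\<bar>q_value lam v (x, a) - q_value lam v' (x, a)\<bar> \<le> C * \<gamma> * w x"
proof -
  have "q_value lam v (x, a) - q_value lam v' (x, a) = \<beta> * (\<integral>y. v y - v' y \<partial>\<kappa> a x)"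
    by (cases "\<beta> = 0")
       (simp_all add: q_value_def Bochner_Integration.integral_diff integrable_weight_bounded[OF x _ v]
        integrable_weight_bounded[OF x _ v'] right_diff_distrib)
  with expectation_bound[OF x d, of a] show ?thesis by simp
qed

lemma weight_bounded_bellman:
  assumes "weight_bounded K v"
  shows "weight_bounded (M * (1 + \<bar>lam\<bar>) + K * \<gamma>) (bellman lam v)"
  unfolding weight_bounded_def bellman_def
proof (intro conjI ballI)
  fix y assume "y \<in> states P"
  from q_value_bound[OF this assms, of lam True] q_value_bound[OF this assms, of lam False]
  show "\<bar>max (q_value lam v (y, True)) (q_value lam v (y, False))\<bar> \<le> (M * (1 + \<bar>lam\<bar>) + K * \<gamma>) * w y"
    by (auto simp: max_def)
qed (intro borel_measurable_max q_value_state_measurable[OF assms])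

text \<open>Dominated convergence under the transition law, with dominating function
  \<open>K * w\<close>. For \<open>\<beta> = 0\<close> the continuation does not enter.\<close>

lemma q_value_tendsto:
  assumes x: "x \<in> states P" and u: "\<And>n. weight_bounded K (u n)" and v: "weight_bounded K v"
    and lim: "\<And>y. y \<in> states P \<Longrightarrow> (\<lambda>n. u n y) \<longlonglongrightarrow> v y"
  shows "(\<lambda>n. q_value lam (u n) (x, a)) \<longlonglongrightarrow> q_value lam v (x, a)"
proof (cases "\<beta> = 0")
  case False
  have "(\<lambda>n. \<integral>y. u n y \<partial>\<kappa> a x) \<longlonglongrightarrow> (\<integral>y. v y \<partial>\<kappa> a x)"
  proof (rule integral_dominated_convergence)
    show "integrable (\<kappa> a x) (\<lambda>y. K * w y)"
      using integrable_weight[OF x False] by simp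
    show "v \<in> borel_measurable (\<kappa> a x)" "u n \<in> borel_measurable (\<kappa> a x)" for n
      using integrable_weight_bounded[OF x False u] integrable_weight_bounded[OF x False v] by auto
    show "AE y in \<kappa> a x. (\<lambda>n. u n y) \<longlonglongrightarrow> v y"
      by (rule AE_I2) (simp add: space_transition[OF x] lim)
    show "AE y in \<kappa> a x. norm (u n y) \<le> K * w y" for n
      using u[of n] by (intro AE_I2) (simp add: space_transition[OF x] weight_bounded_def)
  qed
  then show ?thesis
    unfolding q_value_def by (intro tendsto_intros) simp
qed (simp add: q_value_def)

text \<open>Value iteration from 0 stays in a fixed weighted ball and its increments decay
  geometrically. The pointwise limit is measurable, and continuity of \<open>q_value\<close> along
  the iterates makes it a fixed point.\<close>

lemma bellman_fixed_point:
  obtains K v where "weight_bounded K v" and "\<And>x. x \<in> states P \<Longrightarrow> bellman lam v x = v x"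
proof -
  define C where "C = M * (1 + \<bar>lam\<bar>)"
  \<comment> \<open>The Bellman operator maps radius \<open>K\<close> to
    \<open>C + K * \<gamma>\<close>; this \<open>K\<close> solves
    \<open>C + K * \<gamma> = K\<close>, so the ball is invariant.\<close>
  define K where "K = C / (1 - \<gamma>)"
  define u where "u n = (bellman lam ^^ n) (\<lambda>_. 0)" for n
  have u_Suc: "u (Suc n) = bellman lam (u n)" for n
    by (simp add: u_def)
  have u_0: "u 0 x = 0" for x
    by (simp add: u_def)
  have K_eq: "C + K * \<gamma> = K"
    using rate_less_1 by (simp add: K_def field_simps)
  have C: "0 \<le> C" using bound_pos by (simp add: C_def)
  have K: "0 \<le> K" using C rate_less_1 by (simp add: K_def)
  have u: "weight_bounded K (u n)" for n
  proof (induction n)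
    case 0
    then show ?case
      using K weight_nonneg by (simp add: u_def weight_bounded_def)
  next
    case (Suc n)
    from weight_bounded_bellman[OF this, of lam] show ?case
      by (simp add: u_Suc K_eq flip: C_def)
  qed
  have step: "weight_bounded (C * \<gamma> ^ n) (\<lambda>y. u (Suc n) y - u n y)" for n
  proof (induction n)
    case 0
    have "weight_bounded 0 (\<lambda>_. 0)" by (simp add: weight_bounded_def)
    from weight_bounded_bellman[OF this, of lam] show ?case
      by (simp add: u_Suc C_def) (simp add: u_def)
  next
    case (Suc n)
    show ?case
      unfolding weight_bounded_def
    proof (intro conjI ballI)
      show "(\<lambda>y. u (Suc (Suc n)) y - u (Suc n) y) \<in> borel_measurable (state_space P)"
        by (intro borel_measurable_diff weight_bounded_measurable[OF u])
      fix y assume y: "y \<in> states P"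
      have "\<bar>q_value lam (u (Suc n)) (y, a) - q_value lam (u n) (y, a)\<bar> \<le> C * \<gamma> ^ Suc n * w y" for a
        using q_value_diff[OF y u u Suc, of lam a] by (simp add: ac_simps)
      \<comment> \<open>Taking the maximum over the two actions does not enlarge the
        distance.\<close>
      from this[of True] this[of False]
      show "\<bar>u (Suc (Suc n)) y - u (Suc n) y\<bar> \<le> C * \<gamma> ^ Suc n * w y"
        unfolding u_Suc[of "Suc n"] u_Suc[of n] bellman_def by linarith
    qed
  qed
  \<comment> \<open>Convergence is established on the states only, so every later statement about
    \<open>v\<close> is restricted to them.\<close>
  define v where "v x = lim (\<lambda>n. u n x)" for x
  have lim: "(\<lambda>n. u n x) \<longlonglongrightarrow> v x" if x: "x \<in> states P" for x
  proof -
    have "summable (\<lambda>n. u (Suc n) x - u n x)"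
    proof (rule summable_comparison_test_ev[OF _ summable_rate[of "C * w x"]])
      show "\<forall>\<^sub>F n in sequentially. norm (u (Suc n) x - u n x) \<le> C * w x * \<gamma> ^ n"
        using step x by (intro always_eventually allI) (simp add: weight_bounded_def ac_simps)
    qed
    \<comment> \<open>Since \<open>u 0\<close> vanishes, the partial sums of the increments are the
      iterates themselves.\<close>
    then have "convergent (\<lambda>n. \<Sum>k<n. u (Suc k) x - u k x)"
      by (simp add: summable_iff_convergent)
    then have "convergent (\<lambda>n. u n x)"
      by (simp add: sum_lessThan_telescope[of "\<lambda>n. u n x"] u_0)
    then show ?thesis
      by (simp add: v_def convergent_LIMSEQ_iff)
  qed
  have v: "weight_bounded K v"
    unfolding weight_bounded_def
  proof (intro conjI ballI)
    show "v \<in> borel_measurable (state_space P)"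
      by (rule borel_measurable_LIMSEQ_real[of _ u]) (auto simp: lim weight_bounded_measurable[OF u])
    fix y assume y: "y \<in> states P"
    show "\<bar>v y\<bar> \<le> K * w y"
      by (rule Lim_bounded[OF tendsto_rabs[OF lim[OF y]], of 0]) (use u y in \<open>auto simp: weight_bounded_def\<close>)
  qed
  show thesis
  proof (rule that[OF v])
    fix x assume x: "x \<in> states P"
    have "(\<lambda>n. bellman lam (u n) x) \<longlonglongrightarrow> bellman lam v x"
      unfolding bellman_def by (intro tendsto_max q_value_tendsto[OF x u v lim])
    moreover have "(\<lambda>n. bellman lam (u n) x) \<longlonglongrightarrow> v x"
      using LIMSEQ_Suc[OF lim[OF x]] by (simp add: u_Suc)
    ultimately show "bellman lam v x = v x"
      by (rule LIMSEQ_unique)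
  qed
qed

section \<open>Losses, optimality and a forced first action\<close>

text \<open>The metrics are expectations of whole series; as a series of expectations, the policy
  value can be compared with \<open>v\<close> one time step after another.\<close>

lemma policy_value_sums:
  assumes \<pi>: "\<pi> \<in> policies P" and x: "x \<in> states P"
  shows "(\<lambda>t. \<integral>\<omega>. \<beta> ^ t * net_reward lam (\<omega> t) \<partial>\<mu> \<pi> x) sums policy_value P lam x \<pi>"
proof -
  let ?r = "\<lambda>s. reward P (fst s) (snd s)" and ?c = "\<lambda>s. resource P (fst s) (snd s)"
  have r: "\<bar>?r (y, a)\<bar> \<le> M * w y" and c: "\<bar>?c (y, a)\<bar> \<le> M * w y" if "y \<in> states P" for y a
    using that by (simp_all add: reward_bound resource_bound)
  note ints = integrable_discounted[OF \<pi> x reward_measurable r]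
    integrable_discounted[OF \<pi> x resource_measurable c]
  have "(\<lambda>t. (\<integral>\<omega>. \<beta> ^ t * ?r (\<omega> t) \<partial>\<mu> \<pi> x) - lam * (\<integral>\<omega>. \<beta> ^ t * ?c (\<omega> t) \<partial>\<mu> \<pi> x))
      sums policy_value P lam x \<pi>"
    unfolding policy_value_def reward_metric_def resource_metric_def
    by (intro sums_diff sums_mult sums_expected_discounted[OF \<pi> x reward_measurable r]
        sums_expected_discounted[OF \<pi> x resource_measurable c])
  also have "(\<lambda>t. (\<integral>\<omega>. \<beta> ^ t * ?r (\<omega> t) \<partial>\<mu> \<pi> x) - lam * (\<integral>\<omega>. \<beta> ^ t * ?c (\<omega> t) \<partial>\<mu> \<pi> x))
      = (\<lambda>t. \<integral>\<omega>. \<beta> ^ t * net_reward lam (\<omega> t) \<partial>\<mu> \<pi> x)"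
  proof
    fix t
    have "(\<integral>\<omega>. \<beta> ^ t * ?r (\<omega> t) \<partial>\<mu> \<pi> x) - lam * (\<integral>\<omega>. \<beta> ^ t * ?c (\<omega> t) \<partial>\<mu> \<pi> x)
        = (\<integral>\<omega>. \<beta> ^ t * ?r (\<omega> t) - lam * (\<beta> ^ t * ?c (\<omega> t)) \<partial>\<mu> \<pi> x)"
      using ints by (simp only: Bochner_Integration.integral_diff integrable_mult_right integral_mult_right_zero)
    also have "\<dots> = (\<integral>\<omega>. \<beta> ^ t * net_reward lam (\<omega> t) \<partial>\<mu> \<pi> x)"
      by (simp add: net_reward_def algebra_simps)
    finally show "(\<integral>\<omega>. \<beta> ^ t * ?r (\<omega> t) \<partial>\<mu> \<pi> x) - lam * (\<integral>\<omega>. \<beta> ^ t * ?c (\<omega> t) \<partial>\<mu> \<pi> x)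
        = (\<integral>\<omega>. \<beta> ^ t * net_reward lam (\<omega> t) \<partial>\<mu> \<pi> x)" .
  qed
  finally show ?thesis .
qed

text \<open>
  The expected discounted one-step losses of a policy add up, by telescoping, to its total loss
  against \<open>v\<close>. Both optimality of greedy policies and the value after a forced first action
  are read off this identity.
\<close>

lemma loss_sums:
  assumes \<pi>: "\<pi> \<in> policies P" and x: "x \<in> states P" and v: "weight_bounded K v"
  shows "(\<lambda>t. \<integral>\<omega>. \<beta> ^ t * (v (fst (\<omega> t)) - q_value lam v (\<omega> t)) \<partial>\<mu> \<pi> x)
    sums (v x - policy_value P lam x \<pi>)"
proof -
  let ?C = "M * (1 + \<bar>lam\<bar>)"
  let ?E = "\<lambda>s. \<beta> * (\<integral>y. v y \<partial>\<kappa> (snd s) (fst s))"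
  define e where "e t = (\<integral>\<omega>. \<beta> ^ t * v (fst (\<omega> t)) \<partial>\<mu> \<pi> x)" for t
  have vm: "(\<lambda>s. v (fst s)) \<in> borel_measurable (state_action_space P)"
    by (intro measurable_state_action_space) (simp add: weight_bounded_measurable[OF v])
  have vb: "\<bar>v (fst (y, a))\<bar> \<le> K * w y" if "y \<in> states P" for y and a :: bool
    using v that by (simp add: weight_bounded_def)
  have Em: "?E \<in> borel_measurable (state_action_space P)"
    by (intro borel_measurable_times borel_measurable_const expectation_measurable
        weight_bounded_measurable[OF v])
  have Eb: "\<bar>?E (y, a)\<bar> \<le> K * \<gamma> * w y" if "y \<in> states P" for y a
    using expectation_bound[OF that v] by simp
  note int_v = integrable_discounted[OF \<pi> x vm vb]
  note int_E = integrable_discounted[OF \<pi> x Em Eb]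
  note int_r = integrable_discounted[OF \<pi> x net_reward_measurable net_reward_bound]
  have e0: "e 0 = v x"
  proof -
    have "e 0 = (\<integral>\<omega>. v x \<partial>\<mu> \<pi> x)"
      unfolding e_def
    proof (rule integral_cong_AE)
      show "(\<lambda>\<omega>. \<beta> ^ 0 * v (fst (\<omega> 0))) \<in> borel_measurable (\<mu> \<pi> x)"
        by (rule borel_measurable_integrable[OF int_v])
      show "AE \<omega> in \<mu> \<pi> x. \<beta> ^ 0 * v (fst (\<omega> 0)) = v x"
        using AE_initial[OF \<pi> x] by eventually_elim simp
    qed simp
    then show ?thesis
      using prob_space.prob_space[OF prob_space_trajectory_law(1)[OF discounted \<pi> x]] by simp
  qed
  \<comment> \<open>The discounted terminal value vanishes in the limit, so the telescoping series
    sums to \<open>e 0\<close>, which is \<open>v x\<close>.\<close>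
  have e_lim: "e \<longlonglongrightarrow> 0"
  proof (rule Lim_null_comparison)
    have "norm (e t) \<le> K * w x * \<gamma> ^ t" for t
      unfolding e_def real_norm_def
      by (rule order_trans[OF integral_abs_bound integral_abs_discounted_le[OF \<pi> x vm vb]])
    then show "\<forall>\<^sub>F t in sequentially. norm (e t) \<le> K * w x * \<gamma> ^ t"
      by simp
    show "(\<lambda>t. K * w x * \<gamma> ^ t) \<longlonglongrightarrow> 0"
      by (rule summable_LIMSEQ_zero[OF summable_rate])
  qed
  have "(\<lambda>t. e t - e (Suc t) - (\<integral>\<omega>. \<beta> ^ t * net_reward lam (\<omega> t) \<partial>\<mu> \<pi> x))
      sums (v x - policy_value P lam x \<pi>)"
    using sums_diff[OF telescope_sums'[OF e_lim] policy_value_sums[OF \<pi> x]] by (simp add: e0)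
  also have "(\<lambda>t. e t - e (Suc t) - (\<integral>\<omega>. \<beta> ^ t * net_reward lam (\<omega> t) \<partial>\<mu> \<pi> x))
      = (\<lambda>t. \<integral>\<omega>. \<beta> ^ t * (v (fst (\<omega> t)) - q_value lam v (\<omega> t)) \<partial>\<mu> \<pi> x)"
  proof
    fix t
    have "e t - e (Suc t) - (\<integral>\<omega>. \<beta> ^ t * net_reward lam (\<omega> t) \<partial>\<mu> \<pi> x)
        = (\<integral>\<omega>. \<beta> ^ t * v (fst (\<omega> t)) \<partial>\<mu> \<pi> x) - (\<integral>\<omega>. \<beta> ^ t * ?E (\<omega> t) \<partial>\<mu> \<pi> x)
          - (\<integral>\<omega>. \<beta> ^ t * net_reward lam (\<omega> t) \<partial>\<mu> \<pi> x)"
      unfolding e_def integral_next[OF \<pi> x v] ..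
    also have "\<dots> = (\<integral>\<omega>. \<beta> ^ t * v (fst (\<omega> t)) - \<beta> ^ t * ?E (\<omega> t) - \<beta> ^ t * net_reward lam (\<omega> t) \<partial>\<mu> \<pi> x)"
      using int_v int_E int_r by (simp only: Bochner_Integration.integral_diff Bochner_Integration.integrable_diff)
    also have "\<dots> = (\<integral>\<omega>. \<beta> ^ t * (v (fst (\<omega> t)) - q_value lam v (\<omega> t)) \<partial>\<mu> \<pi> x)"
      by (simp add: q_value_def algebra_simps)
    finally show "e t - e (Suc t) - (\<integral>\<omega>. \<beta> ^ t * net_reward lam (\<omega> t) \<partial>\<mu> \<pi> x)
        = (\<integral>\<omega>. \<beta> ^ t * (v (fst (\<omega> t)) - q_value lam v (\<omega> t)) \<partial>\<mu> \<pi> x)" .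
  qed
  finally show ?thesis .
qed

text \<open>Almost surely the action at time \<open>t\<close> is \<open>d\<close> of the current
  state, where the loss is zero. Only the decision at this one time is constrained.\<close>

lemma expected_loss_0:
  assumes \<pi>: "\<pi> \<in> policies P" and x: "x \<in> states P"
    and act: "\<And>h y. \<pi> t (h, y) = return action_space (d y)"
    and d: "d \<in> state_space P \<rightarrow>\<^sub>M action_space"
    and greedy: "\<And>y. y \<in> states P \<Longrightarrow> q_value lam v (y, d y) = v y"
  shows "(\<integral>\<omega>. \<beta> ^ t * (v (fst (\<omega> t)) - q_value lam v (\<omega> t)) \<partial>\<mu> \<pi> x) = 0"
proof (rule integral_eq_zero_AE)
  show "AE \<omega> in \<mu> \<pi> x. \<beta> ^ t * (v (fst (\<omega> t)) - q_value lam v (\<omega> t)) = 0"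
    using AE_action[OF \<pi> x act d] AE_space
  proof eventually_elim
    case (elim \<omega>)
    from elim(1) have "\<omega> t = (fst (\<omega> t), d (fst (\<omega> t)))"
      by (simp add: prod_eq_iff)
    with greedy[OF space_trajectory[OF \<pi> x elim(2)], of t] have "q_value lam v (\<omega> t) = v (fst (\<omega> t))"
      by metis
    then show ?case by simp
  qed
qed

text \<open>Verification: losses against a fixed point are never negative, so no policy exceeds
  \<open>v x\<close>, and a greedy policy has zero losses and attains it. Thus the supremum over
  policies agrees on the states with a measurable function.\<close>

lemma optimal_value_eq:
  assumes v: "weight_bounded K v" and fp: "\<And>y. y \<in> states P \<Longrightarrow> bellman lam v y = v y"
    and x: "x \<in> states P"
  shows "optimal_value P lam x = v x"
  unfolding optimal_value_def
proof (rule cSup_eq_maximum)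
  \<comment> \<open>Ties go to the active action. Comparing two measurable functions gives a
    measurable selector, hence an admissible policy.\<close>
  define d where "d y \<longleftrightarrow> q_value lam v (y, False) \<le> q_value lam v (y, True)" for y
  define \<pi> :: policy where "\<pi> = (\<lambda>t (h, y). return action_space (d y))"
  have "Measurable.pred (state_space P) d"
    unfolding d_def pred_def by (intro borel_measurable_le q_value_state_measurable[OF v])
  then have d: "d \<in> state_space P \<rightarrow>\<^sub>M action_space"
    by (simp add: action_space_def)
  have \<pi>: "\<pi> \<in> policies P"
    unfolding policies_def \<pi>_def case_prod_beta
    by (auto intro!: measurable_compose[OF _ measurable_return_prob_space]
        measurable_compose[OF measurable_snd d])
  have act: "\<pi> t (h, y) = return action_space (d y)" for t h y
    by (simp add: \<pi>_def)
  have greedy: "q_value lam v (y, d y) = v y" if "y \<in> states P" for y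
    using fp[OF that] by (cases "d y") (auto simp: bellman_def d_def)
  have "(\<lambda>t. 0) sums (v x - policy_value P lam x \<pi>)"
    using loss_sums[OF \<pi> x v, of lam] by (simp only: expected_loss_0[OF \<pi> x act d greedy])
  then have "v x = policy_value P lam x \<pi>"
    by (simp add: sums_iff)
  then show "v x \<in> policy_value P lam x ` policies P"
    using \<pi> by blast
next
  fix z assume "z \<in> policy_value P lam x ` policies P"
  then obtain \<pi> where \<pi>: "\<pi> \<in> policies P" and z: "z = policy_value P lam x \<pi>"
    by blast
  have "0 \<le> v (fst (\<omega> t)) - q_value lam v (\<omega> t)" if "\<omega> \<in> space (\<mu> \<pi> x)" for \<omega> t
    using fp[OF space_trajectory[OF \<pi> x that, of t]] by (cases "\<omega> t"; cases "snd (\<omega> t)") (auto simp: bellman_def)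
  then have "0 \<le> (\<integral>\<omega>. \<beta> ^ t * (v (fst (\<omega> t)) - q_value lam v (\<omega> t)) \<partial>\<mu> \<pi> x)" for t
    using discount_nonneg by (intro integral_nonneg_AE AE_I2) simp
  from sums_le[OF this sums_zero loss_sums[OF \<pi> x v]]
  show "z \<le> v x" by (simp add: z)
qed

text \<open>After time 0 the policy is greedy and loses nothing, so its total loss is the single
  term \<open>v x - q_value lam v (x, a)\<close>. The loss identity then leaves the action value of
  \<open>a\<close>.\<close>

lemma policy_value_action_then:
  assumes x: "x \<in> states P" and \<pi>: "\<pi> \<in> policies P"
    and act: "\<And>t h y. \<pi> t (h, y) = return action_space (d y)"
    and d: "d \<in> state_space P \<rightarrow>\<^sub>M action_space"
    and greedy: "\<And>y b. y \<in> states P \<Longrightarrow> action_value P lam b y \<le> action_value P lam (d y) y"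
  shows "policy_value P lam x (action_then a \<pi>) = action_value P lam a x"
proof -
  obtain K v where v: "weight_bounded K v" and fp: "\<And>y. y \<in> states P \<Longrightarrow> bellman lam v y = v y"
    by (rule bellman_fixed_point[of lam]) blast
  have q: "action_value P lam b y = q_value lam v (y, b)" if y: "y \<in> states P" for b y
  proof -
    \<comment> \<open>The two integrands are known to agree on the states, which form the whole
      space of the transition law.\<close>
    have "(\<integral>y'. optimal_value P lam y' \<partial>\<kappa> b y) = (\<integral>y'. v y' \<partial>\<kappa> b y)"
      by (intro Bochner_Integration.integral_cong refl)
         (simp add: space_transition[OF y] optimal_value_eq[OF v fp])
    then show ?thesis
      by (simp add: action_value_def q_value_def net_reward_def)
  qed
  have gr: "q_value lam v (y, d y) = v y" if y: "y \<in> states P" for y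
    using fp[OF y] greedy[OF y, of True] greedy[OF y, of False]
    by (cases "d y") (auto simp: q[OF y] bellman_def max_def)
  let ?\<pi> = "action_then a \<pi>"
  have \<pi>': "?\<pi> \<in> policies P"
    by (rule action_then_in_policies[OF \<pi>])
  interpret prob_space "\<mu> ?\<pi> x"
    by (rule prob_space_trajectory_law(1)[OF discounted \<pi>' x])
  define L where "L t = (\<integral>\<omega>. \<beta> ^ t * (v (fst (\<omega> t)) - q_value lam v (\<omega> t)) \<partial>\<mu> ?\<pi> x)" for t
  \<comment> \<open>The decisions of \<open>\<pi>\<close> ignore history and time, so the shift made
    by \<open>action_then\<close> leaves the rule \<open>d\<close> unchanged.\<close>
  have L_Suc: "L (Suc t) = 0" for t
    unfolding L_def by (rule expected_loss_0[OF \<pi>' x _ d gr]) (simp add: action_then_def act)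
  have "L 0 = (\<integral>\<omega>. v x - q_value lam v (x, a) \<partial>\<mu> ?\<pi> x)"
    unfolding L_def
  proof (rule integral_cong_AE)
    show "(\<lambda>\<omega>. \<beta> ^ 0 * (v (fst (\<omega> 0)) - q_value lam v (\<omega> 0))) \<in> borel_measurable (\<mu> ?\<pi> x)"
      by (intro borel_measurable_times borel_measurable_diff borel_measurable_const
          measurable_compose[OF fst_component_measurable[OF \<pi>' x] weight_bounded_measurable[OF v]]
          measurable_compose[OF component_measurable[OF \<pi>' x] q_value_measurable[OF v]])
    have "AE \<omega> in \<mu> ?\<pi> x. snd (\<omega> 0) = a"
      \<comment> \<open>At time 0 the rule is the constant decision \<open>a\<close> in place of
        \<open>d\<close>.\<close>
      by (rule AE_action[OF \<pi>' x, of _ "\<lambda>_. a"]) (simp_all add: action_then_def)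
    then show "AE \<omega> in \<mu> ?\<pi> x. \<beta> ^ 0 * (v (fst (\<omega> 0)) - q_value lam v (\<omega> 0)) = v x - q_value lam v (x, a)"
      using AE_initial[OF \<pi>' x]
    proof eventually_elim
      case (elim \<omega>)
      then have "\<omega> 0 = (x, a)" by (simp add: prod_eq_iff)
      then show ?case by simp
    qed
  qed simp
  then have L_0: "L 0 = v x - q_value lam v (x, a)"
    by (simp add: prob_space)
  have "L t = 0" if "t \<notin> {0}" for t
    using L_Suc[of "t - 1"] that by simp
  then have "L sums (\<Sum>t\<in>{0}. L t)"
    by (intro sums_finite) auto
  moreover have "L sums (v x - policy_value P lam x ?\<pi>)"
    unfolding L_def by (rule loss_sums[OF \<pi>' x v])
  ultimately have "L 0 = v x - policy_value P lam x ?\<pi>"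
    using sums_unique2 by fastforce
  with L_0 show ?thesis
    by (simp add: q[OF x])
qed

end

section \<open>Threshold-indexability at the critical price\<close>

text \<open>If the index decreased from \<open>x\<close> to \<open>y\<close>, a price strictly
  between its two values would make the gap positive at \<open>x\<close> and negative at
  \<open>y\<close>. The threshold at that price would then lie strictly below \<open>x\<close> and
  strictly above \<open>y\<close>.\<close>

lemma threshold_indexable_mono:
  assumes "threshold_indexable_with P whittle"
    and xy: "x \<in> states P" "y \<in> states P" "x \<le> y"
  shows "whittle x \<le> whittle y"
proof (rule ccontr)
  assume "\<not> whittle x \<le> whittle y"
  then have "whittle y < whittle x" by simp
  from dense[OF this] obtain lam where lam: "whittle y < lam" "lam < whittle x"
    by blast
  from assms(1) obtain z where
    z: "\<And>x lam. x \<in> states P \<Longrightarrow> (ereal x \<le> z lam \<longrightarrow> action_gap P lam x \<le> 0) \<and>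
        (z lam \<le> ereal x \<longrightarrow> 0 \<le> action_gap P lam x)"
    and s: "\<And>x lam. x \<in> states P \<Longrightarrow> sgn (action_gap P lam x) = sgn (whittle x - lam)"
    unfolding threshold_indexable_with_def thresholdable_def indexable_with_def by metis
  have "0 < action_gap P lam x" "action_gap P lam y < 0"
    using s[OF xy(1), of lam] s[OF xy(2), of lam] lam by (auto simp: sgn_if split: if_splits)
  with z[OF xy(1), of lam] z[OF xy(2), of lam] have "z lam < ereal x" "ereal y < z lam"
    by auto
  then have "ereal y < ereal x" by order
  with xy(3) show False by simp
qed

text \<open>The value of \<open>d\<close> at \<open>x\<close> is left open: at the price
  \<open>whittle x\<close> the gap there is zero, so both actions are greedy. This covers the two
  threshold policies, which differ only at \<open>x\<close>, by one argument.\<close>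

lemma threshold_indexable_marginal:
  assumes P: "discounted_project P" and ti: "threshold_indexable_with P whittle"
    and x: "x \<in> states P" and \<pi>: "\<pi> \<in> policies P"
    and act: "\<And>t h y. \<pi> t (h, y) = return action_space (d y)"
    and d: "d \<in> state_space P \<rightarrow>\<^sub>M action_space"
    and above: "\<And>y. x < y \<Longrightarrow> d y" and below: "\<And>y. y < x \<Longrightarrow> \<not> d y"
  shows "marginal_reward P x \<pi> - whittle x * marginal_resource P x \<pi> = 0"
proof -
  obtain w M \<gamma> where "weight_condition P w M \<gamma>"
    using P by (auto simp: discounted_project_def)
  then interpret weighted_project P w M \<gamma>
    using P by unfold_locales
  let ?lam = "whittle x"
  have s: "sgn (action_gap P ?lam y) = sgn (whittle y - ?lam)" if "y \<in> states P" for y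
    using ti that by (simp add: threshold_indexable_with_def indexable_with_def)
  have ge: "0 \<le> action_gap P ?lam y" if "y \<in> states P" "x \<le> y" for y
    using s[OF that(1)] threshold_indexable_mono[OF ti x that] by (auto simp: sgn_if split: if_splits)
  have le: "action_gap P ?lam y \<le> 0" if "y \<in> states P" "y \<le> x" for y
    using s[OF that(1)] threshold_indexable_mono[OF ti that(1) x that(2)] by (auto simp: sgn_if split: if_splits)
  have greedy: "action_value P ?lam b y \<le> action_value P ?lam (d y) y" if "y \<in> states P" for y b
    using ge[OF that] le[OF that] above[of y] below[of y]
    by (cases y x rule: linorder_cases; cases b; cases "d y") (auto simp: action_gap_def)
  note action_then = policy_value_action_then[OF x \<pi> act d greedy]
  have "marginal_reward P x \<pi> - ?lam * marginal_resource P x \<pi>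
      = policy_value P ?lam x (action_then True \<pi>) - policy_value P ?lam x (action_then False \<pi>)"
    by (simp add: marginal_reward_def marginal_resource_def policy_value_def algebra_simps)
  also have "\<dots> = action_gap P ?lam x"
    by (simp add: action_then action_gap_def)
  also have "\<dots> = 0"
    using ge[OF x] le[OF x] by simp
  finally show ?thesis .
qed

lemma threshold_measurable:
  "(\<lambda>y. z < ereal y) \<in> state_space P \<rightarrow>\<^sub>M action_space"
  "(\<lambda>y. z \<le> ereal y) \<in> state_space P \<rightarrow>\<^sub>M action_space"
  unfolding state_space_def action_space_def
  by (rule measurable_restrict_space1; measurable)+

theorem proposition1:
  fixes P :: project and whittle :: "real \<Rightarrow> real"
  assumes "discounted_project P"
    and "threshold_indexable_with P whittle"
  shows "(\<forall>x\<in>states P.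
      marginal_reward P x (threshold_policy (ereal x))
        - whittle x * marginal_resource P x (threshold_policy (ereal x)) = 0 \<and>
      marginal_reward P x (threshold_policy_left (ereal x))
        - whittle x * marginal_resource P x (threshold_policy_left (ereal x)) = 0) \<and>
    (\<forall>x\<in>states P.
      marginal_resource P x (threshold_policy (ereal x)) \<noteq> 0 \<longrightarrow> whittle x = mp_index P x) \<and>
    ((\<forall>x\<in>states P. \<forall>z :: ereal. marginal_resource P x (threshold_policy z) > 0) \<longrightarrow>
      (\<forall>x\<in>states P. whittle x = mp_index P x))"
proof -
  have a: "marginal_reward P x (threshold_policy (ereal x))
        - whittle x * marginal_resource P x (threshold_policy (ereal x)) = 0"
    if "x \<in> states P" for x
    by (rule threshold_indexable_marginal[OF assms that threshold_policy_in_policies _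
          threshold_measurable(1)[of x]]) (auto simp: threshold_policy_def)
  have a': "marginal_reward P x (threshold_policy_left (ereal x))
        - whittle x * marginal_resource P x (threshold_policy_left (ereal x)) = 0"
    if "x \<in> states P" for x
    by (rule threshold_indexable_marginal[OF assms that threshold_policy_left_in_policies _
          threshold_measurable(2)[of x]]) (auto simp: threshold_policy_left_def)
  have b: "whittle x = mp_index P x"
    if "x \<in> states P" "marginal_resource P x (threshold_policy (ereal x)) \<noteq> 0" for x
    using a[OF that(1)] that(2) by (simp add: mp_index_def field_simps)
  \<comment> \<open>Part (c) reduces to (b) by taking the threshold \<open>z = ereal x\<close> at
    each state \<open>x\<close>, where positivity excludes zero.\<close>
  show ?thesis
    using a a' b by (metis less_irrefl)
qed
end
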